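(* Let $G$ be a compact group and let $M$ be a $G$-homogeneous space. Suppose that $D$ is a compatible $G$-invariant metric on $M$ that is a quotient of some compatible bi-invariant metric $d$ on $G$. Then the Lipschitz-free space $\mathcal{F}(M,D)$ has the metric approximation property.
   Context: A $G$-homogeneous space is a topological space $M$ equipped with a continuous transitive action of $G$; it is identified with the left coset space $G/H$ with the quotient topology, where $H$ is the (closed) stabilizer of a point of $M$. A metric on $M$ (or on $G$) is compatible if it induces the given topology. $D$ is $G$-invariant if $D(gx,gy)=D(x,y)$ for all $g\in G$, $x,y\in M$. A metric $d$ on $G$ is bi-invariant if $d(gx,gy)=d(x,y)=d(xg,yg)$ for all $g,x,y\in G$. The metric $D$ on $M=G/H$ is a quotient of $d$ if $D(gH,fH)=\inf_{h_1,h_2\in H} d(gh_1,fh_2)$ for all $g,f\in G$. For a metric space $M$ with a distinguished point $0\in M$, $\mathrm{Lip}_0(M)$ is the Banach space of real-valued Lipschitz functions on $M$ vanishing at $0$, normed by the minimal Lipschitz constant. The Lipschitz-free space $\mathcal{F}(M)$ is the closed linear span of $\{\delta(x):x\in M\}$ in $\mathrm{Lip}_0(M)^*$, where $\delta(x)(f)=f(x)$ (up to linear isometry it does not depend on the choice of $0$). A Banach space $X$ has the metric approximation property (MAP) if for each compact subset $K$ of $X$ and each $\epsilon>0$ there is a finite rank operator $T$ on $X$ with $\|T\|\le 1$ such that $\|Tx-x\|<\epsilon$ for each $x\in K$. *)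

theory Defs
  imports "HOL-Analysis.Analysis"
begin

section \<open>Homogeneous spaces and their metrics\<close>

text \<open>
  The library's topological groups are written additively; \<^class>\<open>group_add\<close> and hence
  \<^class>\<open>topological_group_add\<close> do not assume commutativity, so \<open>g + h\<close> below stands
  for the product \<open>gh\<close> of an arbitrary topological group.
\<close>

definition compatible_metric :: "('a::topological_space \<Rightarrow> 'a \<Rightarrow> real) \<Rightarrow> bool" where
  "compatible_metric d \<longleftrightarrow>
     Metric_space UNIV d \<and> Metric_space.mtopology UNIV d = (euclidean :: 'a topology)"

definition bi_invariant :: "('g::group_add \<Rightarrow> 'g \<Rightarrow> real) \<Rightarrow> bool" where
  "bi_invariant d \<longleftrightarrow> (\<forall>g x y. d (g + x) (g + y) = d x y \<and> d (x + g) (y + g) = d x y)"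

definition homogeneous_space ::
    "('g::topological_group_add \<Rightarrow> 'm::topological_space \<Rightarrow> 'm) \<Rightarrow> bool" where
  "homogeneous_space act \<longleftrightarrow>
     (\<forall>x. act 0 x = x) \<and>
     (\<forall>g h x. act (g + h) x = act g (act h x)) \<and>
     continuous_on UNIV (\<lambda>(g, x). act g x) \<and>
     (\<forall>x y. \<exists>g. act g x = y)"

definition invariant_metric ::
    "('g \<Rightarrow> 'm \<Rightarrow> 'm) \<Rightarrow> ('m \<Rightarrow> 'm \<Rightarrow> real) \<Rightarrow> bool" where
  "invariant_metric act D \<longleftrightarrow> (\<forall>g x y. D (act g x) (act g y) = D x y)"

definition stabilizer :: "('g \<Rightarrow> 'm \<Rightarrow> 'm) \<Rightarrow> 'm \<Rightarrow> 'g set" where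
  "stabilizer act p = {g. act g p = p}"

text \<open>
  With \<open>H\<close> the stabilizer of \<open>p\<close>, the space is identified with \<open>G/H\<close> by letting
  \<open>gH\<close> correspond to \<open>act g p\<close>.
\<close>

definition quotient_metric ::
    "('g::group_add \<Rightarrow> 'm \<Rightarrow> 'm) \<Rightarrow> 'm \<Rightarrow> ('g \<Rightarrow> 'g \<Rightarrow> real) \<Rightarrow> ('m \<Rightarrow> 'm \<Rightarrow> real) \<Rightarrow> bool" where
  "quotient_metric act p d D \<longleftrightarrow>
     (\<forall>g f. D (act g p) (act f p) =
        Inf {d (g + h1) (f + h2) | h1 h2. h1 \<in> stabilizer act p \<and> h2 \<in> stabilizer act p})"


section \<open>The space of Lipschitz functions vanishing at the base point\<close>

text \<open>
  The distinguished point is part of the type class, so a statement about all types of this class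
  is a statement about all metric spaces with all choices of the distinguished point.  The metric
  is the class operation \<open>dist\<close>, which by the axioms of \<^class>\<open>metric_space\<close> induces the topology
  of the type: it is an arbitrary compatible metric on the underlying topological space.
\<close>

class pointed_metric_space = metric_space +
  fixes base_point :: 'a

typedef (overloaded) ('m::pointed_metric_space) lip0 =
  "{f :: 'm \<Rightarrow> real. f base_point = 0 \<and> (\<exists>L. L-lipschitz_on UNIV f)}"
  morphisms lip0_fun Abs_lip0
  by (rule exI[of _ "\<lambda>_. 0"]) (auto intro!: exI[of _ 0] simp: lipschitz_on_def)

setup_lifting type_definition_lip0

definition lip_const :: "('m::metric_space \<Rightarrow> real) \<Rightarrow> real" where
  "lip_const f = Inf {L. L-lipschitz_on UNIV f}"

lemma lip_const_le: "L-lipschitz_on UNIV f \<Longrightarrow> lip_const f \<le> L"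
  unfolding lip_const_def
  by (rule cInf_lower) (auto intro!: bdd_belowI[of _ 0] dest: lipschitz_on_nonneg)

lemma lip_const_lipschitz:
  assumes "L-lipschitz_on UNIV f"
  shows "(lip_const f)-lipschitz_on UNIV f"
proof (rule lipschitz_onI)
  have ne: "{L. L-lipschitz_on UNIV f} \<noteq> {}"
    using assms by auto
  show "0 \<le> lip_const f"
    unfolding lip_const_def
    by (rule cInf_greatest[OF ne]) (auto dest: lipschitz_on_nonneg)
  fix x y :: 'a
  show "dist (f x) (f y) \<le> lip_const f * dist x y"
  proof (cases "x = y")
    case False
    then have pos: "0 < dist x y" by simp
    have "dist (f x) (f y) / dist x y \<le> lip_const f"
      unfolding lip_const_def
    proof (rule cInf_greatest[OF ne])
      fix L assume "L \<in> {L. L-lipschitz_on UNIV f}"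
      then show "dist (f x) (f y) / dist x y \<le> L"
        using pos by (auto simp: divide_le_eq dest: lipschitz_onD[of _ _ _ x y])
    qed
    then show ?thesis
      using pos by (simp add: divide_le_eq)
  qed simp
qed

lemma lip_const_nonneg: "L-lipschitz_on UNIV f \<Longrightarrow> 0 \<le> lip_const f"
  using lip_const_lipschitz lipschitz_on_nonneg by blast

instantiation lip0 :: (pointed_metric_space) real_vector
begin

lift_definition zero_lip0 :: "'a lip0" is "\<lambda>_. 0"
  by (auto intro!: exI[of _ 0] simp: lipschitz_on_def)

lift_definition plus_lip0 :: "'a lip0 \<Rightarrow> 'a lip0 \<Rightarrow> 'a lip0" is "\<lambda>f g x. f x + g x"
  by (auto intro: lipschitz_on_add)

lift_definition uminus_lip0 :: "'a lip0 \<Rightarrow> 'a lip0" is "\<lambda>f x. - f x"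
  by (auto intro: lipschitz_on_minus)

lift_definition minus_lip0 :: "'a lip0 \<Rightarrow> 'a lip0 \<Rightarrow> 'a lip0" is "\<lambda>f g x. f x - g x"
  by (auto intro: lipschitz_on_diff)

lift_definition scaleR_lip0 :: "real \<Rightarrow> 'a lip0 \<Rightarrow> 'a lip0" is "\<lambda>r f x. r * f x"
  by (auto intro: lipschitz_on_cmult_real)

instance
  by standard (transfer; simp add: fun_eq_iff algebra_simps)+

end

instantiation lip0 :: (pointed_metric_space) real_normed_vector
begin

lift_definition norm_lip0 :: "'a lip0 \<Rightarrow> real" is lip_const .

definition dist_lip0 :: "'a lip0 \<Rightarrow> 'a lip0 \<Rightarrow> real" where
  "dist_lip0 f g = norm (f - g)"

definition sgn_lip0 :: "'a lip0 \<Rightarrow> 'a lip0" where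
  "sgn_lip0 f = f /\<^sub>R norm f"

definition uniformity_lip0 :: "('a lip0 \<times> 'a lip0) filter" where
  "uniformity_lip0 = (INF e\<in>{0 <..}. principal {(f, g). dist f g < e})"

definition open_lip0 :: "'a lip0 set \<Rightarrow> bool" where
  "open_lip0 S \<longleftrightarrow> (\<forall>f\<in>S. \<forall>\<^sub>F (f', g) in uniformity. f' = f \<longrightarrow> g \<in> S)"

instance
proof
  fix f g :: "'a lip0" and r :: real
  show "norm f = 0 \<longleftrightarrow> f = 0"
  proof transfer
    fix f :: "'a \<Rightarrow> real"
    assume f: "f base_point = 0 \<and> (\<exists>L. L-lipschitz_on UNIV f)"
    then have lip: "(lip_const f)-lipschitz_on UNIV f"
      using lip_const_lipschitz by blast
    show "lip_const f = 0 \<longleftrightarrow> f = (\<lambda>_. 0)"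
    proof
      assume "lip_const f = 0"
      then have "f x = f base_point" for x
        using lipschitz_onD[OF lip, of x base_point] by simp
      then show "f = (\<lambda>_. 0)" using f by auto
    next
      assume "f = (\<lambda>_. 0)"
      then have "0-lipschitz_on UNIV f" by (simp add: lipschitz_on_def)
      then show "lip_const f = 0"
        using lip_const_le lip_const_nonneg by (metis order_antisym)
    qed
  qed
  show "norm (f + g) \<le> norm f + norm g"
    by transfer (blast intro: lip_const_le lipschitz_on_add lip_const_lipschitz)
  show "norm (r *\<^sub>R f) = \<bar>r\<bar> * norm f"
  proof transfer
    fix r :: real and f :: "'a \<Rightarrow> real"
    assume "f base_point = 0 \<and> (\<exists>L. L-lipschitz_on UNIV f)"
    then obtain L where L: "L-lipschitz_on UNIV f" by blast
    have le: "lip_const (\<lambda>x. s * h x) \<le> \<bar>s\<bar> * lip_const h" if "K-lipschitz_on UNIV h"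
      for s :: real and h :: "'a \<Rightarrow> real" and K
      by (rule lip_const_le[OF lipschitz_on_cmult_real[OF lip_const_lipschitz[OF that]]])
    show "lip_const (\<lambda>x. r * f x) = \<bar>r\<bar> * lip_const f"
    proof (cases "r = 0")
      case True
      have "0-lipschitz_on UNIV (\<lambda>x::'a. 0::real)" by (simp add: lipschitz_on_def)
      then have "lip_const (\<lambda>x::'a. 0) = 0"
        using lip_const_le lip_const_nonneg by (metis order_antisym)
      then show ?thesis using True by simp
    next
      case False
      have "lip_const (\<lambda>x. inverse r * (r * f x)) \<le> \<bar>inverse r\<bar> * lip_const (\<lambda>x. r * f x)"
        by (rule le[OF lipschitz_on_cmult_real[OF L]])
      moreover have "(\<lambda>x. inverse r * (r * f x)) = f" using False by auto
      ultimately have "\<bar>r\<bar> * lip_const f \<le> lip_const (\<lambda>x. r * f x)"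
        using False by (simp add: field_simps)
      then show ?thesis using le[OF L, of r] by linarith
    qed
  qed
qed (simp_all add: dist_lip0_def sgn_lip0_def uniformity_lip0_def open_lip0_def)

end


section \<open>The Lipschitz-free space\<close>

lift_definition delta :: "'m::pointed_metric_space \<Rightarrow> 'm lip0 \<Rightarrow>\<^sub>L real" is "\<lambda>x f. lip0_fun f x"
proof -
  fix x :: 'm
  show "bounded_linear (\<lambda>f. lip0_fun f x)"
  proof (rule bounded_linear_intro[where K = "dist x base_point"])
    fix f g :: "'m lip0" and r :: real
    show "lip0_fun (f + g) x = lip0_fun f x + lip0_fun g x" by transfer simp
    show "lip0_fun (r *\<^sub>R f) x = r *\<^sub>R lip0_fun f x" by transfer simp
    show "norm (lip0_fun f x) \<le> norm f * dist x base_point"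
    proof transfer
      fix f :: "'m \<Rightarrow> real" and x :: 'm
      assume f: "f base_point = 0 \<and> (\<exists>L. L-lipschitz_on UNIV f)"
      then have "(lip_const f)-lipschitz_on UNIV f"
        using lip_const_lipschitz by blast
      from lipschitz_onD[OF this, of x base_point] f
      show "norm (f x) \<le> lip_const f * dist x base_point" by simp
    qed
  qed
qed

typedef (overloaded) ('m::pointed_metric_space) lipschitz_free =
  "closure (span (range delta)) :: ('m lip0 \<Rightarrow>\<^sub>L real) set"
  morphisms free_functional Abs_lipschitz_free
  using closure_subset span_zero by blast

setup_lifting type_definition_lipschitz_free

lemma subspace_lipschitz_free:
  "subspace (closure (span (range (delta :: 'a::pointed_metric_space \<Rightarrow> _))))"
proof (rule subspaceI)
  let ?S = "span (range (delta :: 'a \<Rightarrow> _))"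
  show "0 \<in> closure ?S"
    using closure_subset span_zero by blast
  fix u v assume "u \<in> closure ?S" "v \<in> closure ?S"
  then obtain a b where a: "\<And>n. a n \<in> ?S" "a \<longlonglongrightarrow> u" and b: "\<And>n. b n \<in> ?S" "b \<longlonglongrightarrow> v"
    unfolding closure_sequential by blast
  have "\<forall>n. a n + b n \<in> ?S" "(\<lambda>n. a n + b n) \<longlonglongrightarrow> u + v"
    using a b by (auto intro: span_add tendsto_add)
  then show "u + v \<in> closure ?S"
    unfolding closure_sequential by (intro exI[of _ "\<lambda>n. a n + b n"]) simp
next
  let ?S = "span (range (delta :: 'a \<Rightarrow> _))"
  fix r u assume "u \<in> closure ?S"
  then obtain a where a: "\<And>n. a n \<in> ?S" "a \<longlonglongrightarrow> u"
    unfolding closure_sequential by blast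
  have "\<forall>n. r *\<^sub>R a n \<in> ?S" "(\<lambda>n. r *\<^sub>R a n) \<longlonglongrightarrow> r *\<^sub>R u"
    using a by (auto intro: span_scale tendsto_scaleR)
  then show "r *\<^sub>R u \<in> closure ?S"
    unfolding closure_sequential by (intro exI[of _ "\<lambda>n. r *\<^sub>R a n"]) simp
qed

instantiation lipschitz_free :: (pointed_metric_space) real_vector
begin

lift_definition zero_lipschitz_free :: "'a lipschitz_free" is 0
  by (rule subspace_0[OF subspace_lipschitz_free])

lift_definition plus_lipschitz_free ::
  "'a lipschitz_free \<Rightarrow> 'a lipschitz_free \<Rightarrow> 'a lipschitz_free" is "(+)"
  by (rule subspace_add[OF subspace_lipschitz_free])

lift_definition uminus_lipschitz_free :: "'a lipschitz_free \<Rightarrow> 'a lipschitz_free" is uminus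
  by (rule subspace_neg[OF subspace_lipschitz_free])

lift_definition minus_lipschitz_free ::
  "'a lipschitz_free \<Rightarrow> 'a lipschitz_free \<Rightarrow> 'a lipschitz_free" is "(-)"
  by (rule subspace_diff[OF subspace_lipschitz_free])

lift_definition scaleR_lipschitz_free ::
  "real \<Rightarrow> 'a lipschitz_free \<Rightarrow> 'a lipschitz_free" is "(*\<^sub>R)"
  by (rule subspace_scale[OF subspace_lipschitz_free])

instance
  by standard (transfer; simp add: algebra_simps)+

end

instantiation lipschitz_free :: (pointed_metric_space) real_normed_vector
begin

lift_definition norm_lipschitz_free :: "'a lipschitz_free \<Rightarrow> real" is norm .

definition dist_lipschitz_free :: "'a lipschitz_free \<Rightarrow> 'a lipschitz_free \<Rightarrow> real" where
  "dist_lipschitz_free u v = norm (u - v)"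

definition sgn_lipschitz_free :: "'a lipschitz_free \<Rightarrow> 'a lipschitz_free" where
  "sgn_lipschitz_free u = u /\<^sub>R norm u"

definition uniformity_lipschitz_free :: "('a lipschitz_free \<times> 'a lipschitz_free) filter" where
  "uniformity_lipschitz_free = (INF e\<in>{0 <..}. principal {(u, v). dist u v < e})"

definition open_lipschitz_free :: "'a lipschitz_free set \<Rightarrow> bool" where
  "open_lipschitz_free S \<longleftrightarrow> (\<forall>u\<in>S. \<forall>\<^sub>F (u', v) in uniformity. u' = u \<longrightarrow> v \<in> S)"

instance
proof
  fix u v :: "'a lipschitz_free" and r :: real
  show "norm u = 0 \<longleftrightarrow> u = 0" by transfer simp
  show "norm (u + v) \<le> norm u + norm v" by transfer (rule norm_triangle_ineq)
  show "norm (r *\<^sub>R u) = \<bar>r\<bar> * norm u" by transfer simp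
qed (simp_all add: dist_lipschitz_free_def sgn_lipschitz_free_def
      uniformity_lipschitz_free_def open_lipschitz_free_def)

end

lemma dist_free_functional: "dist (free_functional u) (free_functional v) = dist u v"
  by (simp add: dist_norm dist_lipschitz_free_def norm_lipschitz_free.rep_eq
      minus_lipschitz_free.rep_eq)

instance lipschitz_free :: (pointed_metric_space) banach
proof
  fix X :: "nat \<Rightarrow> 'a lipschitz_free"
  assume "Cauchy X"
  then have "Cauchy (\<lambda>n. free_functional (X n))"
    by (simp add: Cauchy_def dist_free_functional)
  then obtain l where l: "(\<lambda>n. free_functional (X n)) \<longlonglongrightarrow> l"
    using Cauchy_convergent convergent_def by blast
  have "l \<in> closure (span (range delta))"
    by (rule closed_sequentially[OF closed_closure _ l]) (rule free_functional)
  then obtain u where "l = free_functional u"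
    by (metis Abs_lipschitz_free_inverse)
  with l have "X \<longlonglongrightarrow> u"
    by (simp add: tendsto_iff dist_free_functional)
  then show "convergent X"
    by (auto simp: convergent_def)
qed


section \<open>The metric approximation property\<close>

definition finite_rank :: "('a::real_normed_vector \<Rightarrow>\<^sub>L 'b::real_normed_vector) \<Rightarrow> bool" where
  "finite_rank T \<longleftrightarrow> (\<exists>B. finite B \<and> range (blinfun_apply T) \<subseteq> span B)"

definition metric_approximation_property :: "'a::banach itself \<Rightarrow> bool" where
  "metric_approximation_property TYPE('a) \<longleftrightarrow>
     (\<forall>K :: 'a set. compact K \<longrightarrow>
       (\<forall>e>0. \<exists>T :: 'a \<Rightarrow>\<^sub>L 'a.
          finite_rank T \<and> norm T \<le> 1 \<and> (\<forall>x\<in>K. norm (blinfun_apply T x - x) < e)))"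

end

(*
  Averaging a Lipschitz function f over its translates, f(x) |-> mean of phi(g) f(g x) over the
  group, with phi a normalized bump near the identity, does not increase the Lipschitz constant,
  since the metric is invariant, and is close to the identity.  Writing x = k p, right invariance
  of the mean turns f(g x) into f(g p) and phi(g) into phi(g k^-1), which is Lipschitz in k because
  d is bi-invariant; as dist is a quotient of d, the averaging operator maps bounded functions to
  Lipschitz functions, with a Lipschitz constant controlled by the sup norm.  Composing it with a
  finite rank sup-norm approximation by a partition of unity gives finite rank operators on Lip_0
  of norm at most 1 + e; these have pre-adjoints on the free space, which are rescaled to norm 1.
  The mean is von Neumann's: the constant that averages of right translates approach uniformly.
*)

theory Submission
  imports Defs
begin

section \<open>Finite rank operators on Lipschitz-free spaces\<close>

lemma lip0_fun_base_point: "lip0_fun f base_point = 0"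
  using lip0_fun[of f] by simp

lemma lip0_fun_add: "lip0_fun (f + g) x = lip0_fun f x + lip0_fun g x"
  by transfer simp

lemma lip0_fun_scaleR: "lip0_fun (c *\<^sub>R f) x = c * lip0_fun f x"
  by transfer simp

lemma lip0_fun_zero: "lip0_fun 0 x = 0"
  by transfer simp

lemma lip0_fun_sum: "lip0_fun (\<Sum>i\<in>I. F i) x = (\<Sum>i\<in>I. lip0_fun (F i) x)"
  by (induction I rule: infinite_finite_induct) (simp_all add: lip0_fun_add lip0_fun_zero)

lemma lip0_fun_lipschitz: "(norm f)-lipschitz_on UNIV (lip0_fun f)"
  by transfer (blast intro: lip_const_lipschitz)

lemma norm_lip0_le: "L-lipschitz_on UNIV (lip0_fun f) \<Longrightarrow> norm f \<le> L"
  by transfer (rule lip_const_le)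

section \<open>Point masses, and elements of the free space as functionals\<close>

lift_definition free_delta :: "'m::pointed_metric_space \<Rightarrow> 'm lipschitz_free" is delta
  by (intro subsetD[OF closure_subset] span_base rangeI)

lemma free_functional_free_delta: "free_functional (free_delta x) f = lip0_fun f x"
  by (simp add: free_delta.rep_eq delta.rep_eq)

lemma free_functional_add: "free_functional (u + v) f = free_functional u f + free_functional v f"
  by (simp add: plus_lipschitz_free.rep_eq blinfun.add_left)

lemma free_functional_diff: "free_functional (u - v) f = free_functional u f - free_functional v f"
  by (simp add: minus_lipschitz_free.rep_eq blinfun.diff_left)

lemma free_functional_scaleR: "free_functional (c *\<^sub>R u) f = c * free_functional u f"
  by (simp add: scaleR_lipschitz_free.rep_eq blinfun.scaleR_left)

lemma free_functional_sum: "free_functional (\<Sum>i\<in>I. u i) f = (\<Sum>i\<in>I. free_functional (u i) f)"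
  by (induction I rule: infinite_finite_induct)
    (simp_all add: free_functional_add zero_lipschitz_free.rep_eq)

lemma abs_free_functional_le: "\<bar>free_functional u f\<bar> \<le> norm u * norm f"
  using norm_blinfun[of "free_functional u" f] by (simp add: norm_lipschitz_free.rep_eq)

lemma norm_free_le:
  assumes "0 \<le> C" "\<And>f. \<bar>free_functional u f\<bar> \<le> C * norm f"
  shows "norm u \<le> C"
  unfolding norm_lipschitz_free.rep_eq
  by (rule norm_blinfun_bound) (use assms in auto)

text \<open>Density holds by the definition of the free space; the work is to lift spans of
  functionals to spans in the abstract type.\<close>

lemma span_free_delta_dense:
  fixes u :: "'m::pointed_metric_space lipschitz_free"
  assumes "e > 0"
  shows "\<exists>v\<in>span (range free_delta). dist v u < e"
proof -
  have "\<exists>v\<in>span (range free_delta). free_functional v = w"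
    if "w \<in> span (range delta)" for w :: "'m lip0 \<Rightarrow>\<^sub>L real"
    using that
  proof (induction rule: span_induct_alt)
    case base
    show ?case using span_zero zero_lipschitz_free.rep_eq by blast
  next
    case (step c x w)
    then obtain v where v: "v \<in> span (range free_delta)" "free_functional v = w" by blast
    obtain y where y: "x = delta y" using step.hyps by blast
    have "c *\<^sub>R free_delta y + v \<in> span (range free_delta)"
      by (intro span_add span_scale span_base[OF rangeI] v(1))
    moreover have "free_functional (c *\<^sub>R free_delta y + v) = c *\<^sub>R x + w"
      by (simp add: v(2) y plus_lipschitz_free.rep_eq scaleR_lipschitz_free.rep_eq free_delta.rep_eq)
    ultimately show ?case by blast
  qed
  moreover obtain w where "w \<in> span (range delta)" "dist w (free_functional u) < e"
    using free_functional[of u] assms unfolding closure_approachable by blast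
  ultimately show ?thesis by (metis dist_free_functional)
qed

text \<open>The operator is the pre-adjoint of \<open>f \<mapsto> \<Sum>y\<in>Y. f y *\<^sub>R \<alpha> y\<close>.\<close>

lemma finite_rank_operator:
  fixes \<alpha> :: "'m::pointed_metric_space \<Rightarrow> 'm lip0"
  assumes "0 \<le> K" and K: "\<And>f. norm (\<Sum>y\<in>Y. lip0_fun f y *\<^sub>R \<alpha> y) \<le> K * norm f" and "finite Y"
  shows "\<exists>T. finite_rank T \<and> norm T \<le> K \<and>
    (\<forall>u f. free_functional (blinfun_apply T u) f = free_functional u (\<Sum>y\<in>Y. lip0_fun f y *\<^sub>R \<alpha> y))"
proof -
  \<comment> \<open>This explicit formula keeps the values in the span of the finitely many
    \<open>free_delta y\<close>, so they lie in the free space itself and not merely in the dual of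
    the space of Lipschitz functions.\<close>
  define t where "t u = (\<Sum>y\<in>Y. free_functional u (\<alpha> y) *\<^sub>R free_delta y)" for u :: "'m lipschitz_free"
  have t: "free_functional (t u) f = free_functional u (\<Sum>y\<in>Y. lip0_fun f y *\<^sub>R \<alpha> y)" for u f
    by (simp add: t_def free_functional_sum free_functional_scaleR free_functional_free_delta
        blinfun.sum_right blinfun.scaleR_right mult.commute)
  have norm_t: "norm (t u) \<le> norm u * K" for u
  proof (rule norm_free_le)
    fix f
    have "\<bar>free_functional (t u) f\<bar> \<le> norm u * norm (\<Sum>y\<in>Y. lip0_fun f y *\<^sub>R \<alpha> y)"
      unfolding t by (rule abs_free_functional_le)
    also have "\<dots> \<le> norm u * (K * norm f)" by (intro mult_left_mono K) simp
    finally show "\<bar>free_functional (t u) f\<bar> \<le> norm u * K * norm f" by (simp add: mult.assoc)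
  qed (use \<open>0 \<le> K\<close> in simp)
  have "bounded_linear t"
    using norm_t
    by (intro bounded_linear_intro[where K = K])
      (simp_all add: t_def free_functional_add free_functional_scaleR scaleR_add_left sum.distrib
        scaleR_sum_right)
  then have app: "blinfun_apply (Blinfun t) = t" by (rule bounded_linear_Blinfun_apply)
  have "t u \<in> span (free_delta ` Y)" for u
    unfolding t_def by (intro span_sum span_scale span_base imageI)
  then have "finite_rank (Blinfun t)"
    unfolding finite_rank_def app using \<open>finite Y\<close> by blast
  moreover have "norm (Blinfun t) \<le> K"
    by (rule norm_blinfun_bound) (use \<open>0 \<le> K\<close> norm_t in \<open>auto simp: app mult.commute\<close>)
  ultimately show ?thesis using t app by metis
qed

text \<open>Uniform closeness on point masses passes to each fixed element of their span; density
  and the common bound 1 on the norms then extend it to compact sets.\<close>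

lemma metric_approximation_property_lipschitz_freeI:
  assumes "\<And>e. e > 0 \<Longrightarrow> \<exists>T :: 'm::pointed_metric_space lipschitz_free \<Rightarrow>\<^sub>L 'm lipschitz_free.
    finite_rank T \<and> norm T \<le> 1 \<and> (\<forall>x. norm (blinfun_apply T (free_delta x) - free_delta x) \<le> e)"
  shows "metric_approximation_property TYPE('m lipschitz_free)"
  unfolding metric_approximation_property_def
proof (intro allI impI)
  fix K :: "'m lipschitz_free set" and e :: real
  assume K: "compact K" and "e > 0"
  \<comment> \<open>\<open>C\<close> is a sum of absolute values of coefficients in a representation
    of \<open>v\<close>. It must not depend on \<open>T\<close> or \<open>r\<close>, because
    \<open>T\<close> is chosen only after the net \<open>V\<close>.\<close>
  have "\<exists>C\<ge>0. \<forall>(T :: 'm lipschitz_free \<Rightarrow>\<^sub>L 'm lipschitz_free) r.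
      (\<forall>x. norm (T (free_delta x) - free_delta x) \<le> r) \<longrightarrow> norm (T v - v) \<le> C * r"
    if "v \<in> span (range free_delta)" for v :: "'m lipschitz_free"
    using that
  proof (induction rule: span_induct_alt)
    case base
    show ?case by (rule exI[of _ 0]) simp
  next
    case (step c x v)
    then obtain C y where C: "C \<ge> 0" "\<And>(T :: 'm lipschitz_free \<Rightarrow>\<^sub>L 'm lipschitz_free) r.
      (\<forall>x. norm (T (free_delta x) - free_delta x) \<le> r) \<Longrightarrow> norm (T v - v) \<le> C * r"
      and x: "x = free_delta y" by blast
    have "norm (T (c *\<^sub>R x + v) - (c *\<^sub>R x + v)) \<le> (\<bar>c\<bar> + C) * r"
      if T: "\<forall>x. norm (T (free_delta x) - free_delta x) \<le> r"
      for T :: "'m lipschitz_free \<Rightarrow>\<^sub>L 'm lipschitz_free" and r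
    proof -
      have "T (c *\<^sub>R x + v) - (c *\<^sub>R x + v) = c *\<^sub>R (T x - x) + (T v - v)"
        by (simp add: blinfun.add_right blinfun.scaleR_right algebra_simps)
      then have "norm (T (c *\<^sub>R x + v) - (c *\<^sub>R x + v)) \<le> \<bar>c\<bar> * norm (T x - x) + norm (T v - v)"
        by (metis norm_triangle_ineq norm_scaleR)
      also have "\<dots> \<le> \<bar>c\<bar> * r + C * r"
        using T C(2)[OF T] by (intro add_mono mult_left_mono) (auto simp: x)
      finally show ?thesis by (simp add: algebra_simps)
    qed
    then show ?case using C(1) by (intro exI[of _ "\<bar>c\<bar> + C"]) auto
  qed
  then obtain C where C: "\<And>v. v \<in> span (range free_delta) \<Longrightarrow> C v \<ge> 0"
    "\<And>v (T :: 'm lipschitz_free \<Rightarrow>\<^sub>L 'm lipschitz_free) r.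
      v \<in> span (range free_delta) \<Longrightarrow> \<forall>x. norm (T (free_delta x) - free_delta x) \<le> r \<Longrightarrow>
      norm (T v - v) \<le> C v * r"
    by metis
  have cover: "K \<subseteq> (\<Union>v\<in>span (range free_delta). ball v (e / 4))"
    using span_free_delta_dense[of "e / 4"] \<open>e > 0\<close> by force
  obtain V where V: "V \<subseteq> span (range free_delta)" "finite V"
    "K \<subseteq> (\<Union>v\<in>V. ball v (e / 4))"
    using compactE_image[OF K open_ball cover] by blast
  \<comment> \<open>A common bound for all \<open>C v\<close>; the summand 1 keeps it positive for
    the division below.\<close>
  define m where "m = sum C V + 1"
  have m: "C v \<le> m" if "v \<in> V" for v
    using member_le_sum[of v V C] that V(1,2) C(1) by (force simp: m_def)
  have "m > 0" using sum_nonneg[of V C] V(1) C(1) by (force simp: m_def)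
  then have "e / (4 * m) > 0" using \<open>e > 0\<close> by simp
  then obtain T :: "'m lipschitz_free \<Rightarrow>\<^sub>L 'm lipschitz_free" where T: "finite_rank T" "norm T \<le> 1"
    "\<forall>x. norm (T (free_delta x) - free_delta x) \<le> e / (4 * m)"
    using assms by blast
  have "norm (T x - x) < e" if "x \<in> K" for x
  proof -
    obtain v where "v \<in> V" "x \<in> ball v (e / 4)" using V(3) \<open>x \<in> K\<close> by blast
    then have v: "v \<in> V" "norm (x - v) < e / 4"
      by (simp_all add: dist_norm norm_minus_commute)
    have "norm (T (x - v)) \<le> 1 * norm (x - v)"
      using norm_blinfun[of T "x - v"] mult_right_mono[OF T(2), of "norm (x - v)"] by simp
    moreover have "norm (T v - v) \<le> e / 4"
    proof -
      have "norm (T v - v) \<le> C v * (e / (4 * m))" using C(2) V(1) v(1) T(3) by blast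
      also have "\<dots> \<le> m * (e / (4 * m))"
        using \<open>e / (4 * m) > 0\<close> by (intro mult_right_mono m v) simp
      finally show ?thesis using \<open>m > 0\<close> by simp
    qed
    \<comment> \<open>Each of the three parts has norm at most \<open>e / 4\<close>, which leaves
      room for the strict inequality.\<close>
    moreover have eq: "T x - x = T (x - v) + (T v - v) - (x - v)"
      by (simp add: blinfun.diff_right)
    have "norm (T x - x) \<le> norm (T (x - v)) + norm (T v - v) + norm (x - v)"
      unfolding eq using norm_triangle_ineq4[of "T (x - v) + (T v - v)" "x - v"]
        norm_triangle_ineq[of "T (x - v)" "T v - v"] by linarith
    ultimately show ?thesis using v(2) \<open>e > 0\<close> by linarith
  qed
  then show "\<exists>T :: 'm lipschitz_free \<Rightarrow>\<^sub>L 'm lipschitz_free. finite_rank T \<and> norm T \<le> 1 \<and>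
      (\<forall>x\<in>K. norm (T x - x) < e)"
    using T(1,2) by blast
qed

text \<open>Dividing by \<open>1 + e\<close> turns almost contractions into contractions.
  Boundedness makes this harmless, since the values of \<open>f\<close> are bounded by a multiple of
  its Lipschitz constant.\<close>

lemma metric_approximation_property_lipschitz_free_if_approximable:
  assumes bdd: "bounded (UNIV :: 'm::pointed_metric_space set)"
    and approx: "\<And>e. e > 0 \<Longrightarrow> \<exists>Y (a :: 'm \<Rightarrow> 'm \<Rightarrow> real). finite Y \<and>
      (\<forall>y\<in>Y. \<exists>K. K-lipschitz_on UNIV (a y)) \<and>
      (\<forall>f K. K-lipschitz_on UNIV f \<longrightarrow>
        ((1 + e) * K)-lipschitz_on UNIV (\<lambda>x. \<Sum>y\<in>Y. f y * a y x) \<and>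
        (\<forall>x. \<bar>(\<Sum>y\<in>Y. f y * a y x) - f x\<bar> \<le> e * K))"
  shows "metric_approximation_property TYPE('m lipschitz_free)"
proof (rule metric_approximation_property_lipschitz_freeI)
  fix e :: real assume "e > 0"
  obtain b where b: "\<And>x::'m. dist x base_point \<le> b" "b \<ge> 0"
  proof -
    obtain b where "\<forall>x::'m. dist base_point x \<le> b"
      using bdd bounded_any_center[of UNIV base_point] by auto
    then show ?thesis using that[of b] by (metis dist_commute zero_le_dist order_trans)
  qed
  \<comment> \<open>The final error is \<open>\<eta>\<close> times \<open>norm f\<close> at
    \<open>x\<close>, the same again at the base point, and \<open>b\<close> times as much from the
    rescaling.\<close>
  define \<eta> where "\<eta> = e / (2 + b)"
  have \<eta>: "\<eta> > 0" "\<eta> * (2 + b) = e" using \<open>e > 0\<close> b(2) by (auto simp: \<eta>_def)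
  obtain Y and a :: "'m \<Rightarrow> 'm \<Rightarrow> real" where Y: "finite Y"
    and a: "\<And>y. y \<in> Y \<Longrightarrow> \<exists>K. K-lipschitz_on UNIV (a y)"
    and lip: "\<And>f K. K-lipschitz_on UNIV f \<Longrightarrow>
      ((1 + \<eta>) * K)-lipschitz_on UNIV (\<lambda>x. \<Sum>y\<in>Y. f y * a y x)"
    and close: "\<And>f K x. K-lipschitz_on UNIV f \<Longrightarrow> \<bar>(\<Sum>y\<in>Y. f y * a y x) - f x\<bar> \<le> \<eta> * K"
    using approx[OF \<eta>(1)] by blast
  \<comment> \<open>Subtracting a constant makes the function vanish at the base point without
    changing its Lipschitz constant; the denominator does the rescaling.\<close>
  define \<alpha> where "\<alpha> y = Abs_lip0 (\<lambda>x. (a y x - a y base_point) / (1 + \<eta>))" for y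
  have \<alpha>: "lip0_fun (\<alpha> y) x = (a y x - a y base_point) / (1 + \<eta>)" if y: "y \<in> Y" for x y
  proof -
    obtain K where "K-lipschitz_on UNIV (a y)" using a[OF y] by blast
    then have "(\<bar>1 / (1 + \<eta>)\<bar> * (K + 0))-lipschitz_on UNIV
        (\<lambda>x. 1 / (1 + \<eta>) * (a y x - a y base_point))"
      by (intro lipschitz_on_cmult_real lipschitz_on_diff) (simp_all add: lipschitz_on_def)
    then have "\<exists>L. L-lipschitz_on UNIV (\<lambda>x. (a y x - a y base_point) / (1 + \<eta>))" by auto
    then show ?thesis by (simp add: \<alpha>_def Abs_lip0_inverse)
  qed
  define S where "S f x = (\<Sum>y\<in>Y. lip0_fun f y * a y x)" for f :: "'m lip0" and x
  have S: "lip0_fun (\<Sum>y\<in>Y. lip0_fun f y *\<^sub>R \<alpha> y) x = (S f x - S f base_point) / (1 + \<eta>)" for f x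
    by (simp add: lip0_fun_sum lip0_fun_scaleR \<alpha> S_def right_diff_distrib
        flip: sum_subtractf sum_divide_distrib)
  have "norm (\<Sum>y\<in>Y. lip0_fun f y *\<^sub>R \<alpha> y) \<le> 1 * norm f" for f
  proof (rule norm_lip0_le, rule lipschitz_onI)
    fix x z :: 'm
    have "dist (S f x) (S f z) \<le> (1 + \<eta>) * norm f * dist x z"
      unfolding S_def by (rule lipschitz_onD[OF lip[OF lip0_fun_lipschitz]]) auto
    then show "dist (lip0_fun (\<Sum>y\<in>Y. lip0_fun f y *\<^sub>R \<alpha> y) x)
        (lip0_fun (\<Sum>y\<in>Y. lip0_fun f y *\<^sub>R \<alpha> y) z) \<le> 1 * norm f * dist x z"
      using \<eta>(1) unfolding S dist_real_def
      by (simp add: divide_le_eq mult_ac flip: diff_divide_distrib)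
  qed simp
  from finite_rank_operator[OF _ this Y]
  obtain T :: "'m lipschitz_free \<Rightarrow>\<^sub>L 'm lipschitz_free" where T: "finite_rank T" "norm T \<le> 1"
    "\<And>u f. free_functional (T u) f = free_functional u (\<Sum>y\<in>Y. lip0_fun f y *\<^sub>R \<alpha> y)"
    by auto
  have "norm (T (free_delta x) - free_delta x) \<le> e" for x
  proof (rule norm_free_le)
    fix f :: "'m lip0"
    let ?n = "norm f"
    have 1: "\<bar>S f x - lip0_fun f x\<bar> \<le> \<eta> * ?n" and 2: "\<bar>S f base_point\<bar> \<le> \<eta> * ?n"
      using close[OF lip0_fun_lipschitz, of f x] close[OF lip0_fun_lipschitz, of f base_point]
      by (simp_all add: S_def lip0_fun_base_point)
    have "\<bar>lip0_fun f x\<bar> \<le> ?n * dist x base_point"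
      using lipschitz_onD[OF lip0_fun_lipschitz, of x base_point f]
      by (simp add: lip0_fun_base_point)
    also have "\<dots> \<le> ?n * b" by (intro mult_left_mono b) simp
    finally have "\<eta> * \<bar>lip0_fun f x\<bar> \<le> \<eta> * (?n * b)" using \<eta>(1) by simp
    then have 3: "\<bar>\<eta> * lip0_fun f x\<bar> \<le> \<eta> * (?n * b)" using \<eta>(1) by (simp add: abs_mult)
    have "free_functional (T (free_delta x) - free_delta x) f
        = (S f x - S f base_point) / (1 + \<eta>) - lip0_fun f x"
      by (simp add: free_functional_diff T(3) free_functional_free_delta S)
    also have "\<dots> = ((S f x - lip0_fun f x) - S f base_point - \<eta> * lip0_fun f x) / (1 + \<eta>)"
      using \<eta>(1) by (simp add: field_simps)
    finally have "\<bar>free_functional (T (free_delta x) - free_delta x) f\<bar>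
        = \<bar>(S f x - lip0_fun f x) - S f base_point - \<eta> * lip0_fun f x\<bar> / (1 + \<eta>)"
      using \<eta>(1) by simp
    also have "\<dots> \<le> \<bar>(S f x - lip0_fun f x) - S f base_point - \<eta> * lip0_fun f x\<bar>"
      using \<eta>(1) by (simp add: divide_le_eq mult_le_cancel_left1)
    also have "\<dots> \<le> \<eta> * ?n + \<eta> * ?n + \<eta> * (?n * b)" using 1 2 3 by linarith
    also have "\<dots> = e * ?n" using \<eta>(2) by (auto simp: algebra_simps)
    finally show "\<bar>free_functional (T (free_delta x) - free_delta x) f\<bar> \<le> e * ?n" .
  qed (use \<open>e > 0\<close> in simp)
  then show "\<exists>T :: 'm lipschitz_free \<Rightarrow>\<^sub>L 'm lipschitz_free. finite_rank T \<and> norm T \<le> 1 \<and>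
      (\<forall>x. norm (T (free_delta x) - free_delta x) \<le> e)"
    using T(1,2) by blast
qed

section \<open>The invariant mean of a compact group\<close>

text \<open>Iterated uniform means over finite sets of translates. They are encoded as operators, so
  that one average can be applied to several functions, and for an arbitrary family
  \<open>\<tau>\<close>, so that left and right translations are both covered.\<close>

inductive average :: "('i \<Rightarrow> 'a \<Rightarrow> 'a) \<Rightarrow> (('a \<Rightarrow> real) \<Rightarrow> 'a \<Rightarrow> real) \<Rightarrow> bool" for \<tau> where
  average_id: "average \<tau> (\<lambda>f. f)"
| average_step: "average \<tau> A \<Longrightarrow> finite N \<Longrightarrow> N \<noteq> {} \<Longrightarrow>
    average \<tau> (\<lambda>f x. (\<Sum>g\<in>N. A f (\<tau> g x)) / card N)"

lemma average_comp:
  assumes "average \<tau> A" "average \<tau> B"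
  shows "average \<tau> (\<lambda>f. A (B f))"
  using assms(1)
proof induction
  case average_id
  show ?case using assms(2) by simp
next
  case (average_step A N)
  then show ?case using average.average_step[of \<tau> "\<lambda>f. A (B f)" N] by simp
qed

lemma average_translate: "average \<tau> (\<lambda>f x. f (\<tau> g x))"
  using average_step[OF average_id, of "{g}" \<tau>] by simp

lemma average_sum: "average \<tau> A \<Longrightarrow> A (\<lambda>x. \<Sum>i\<in>I. F i x) x = (\<Sum>i\<in>I. A (F i) x)"
proof (induction arbitrary: x rule: average.induct)
  case (average_step A N)
  show ?case
    by (subst sum_divide_distrib[symmetric], subst sum.swap) (simp add: average_step.IH)
qed simp

lemma average_add: "average \<tau> A \<Longrightarrow> A (\<lambda>x. f x + h x) x = A f x + A h x"
  by (induction arbitrary: x rule: average.induct) (simp_all add: sum.distrib add_divide_distrib)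

lemma average_cmult: "average \<tau> A \<Longrightarrow> A (\<lambda>x. c * f x) x = c * A f x"
  by (induction arbitrary: x rule: average.induct) (simp_all add: sum_distrib_left)

lemma average_le:
  assumes "average \<tau> A" "\<And>x. f x \<le> c"
  shows "A f x \<le> c"
  using assms(1)
proof (induction arbitrary: x)
  case (average_step A N)
  have "(\<Sum>g\<in>N. A f (\<tau> g x)) \<le> card N * c"
    using sum_bounded_above[of N "\<lambda>g. A f (\<tau> g x)" c] average_step.IH by simp
  then show ?case
    using average_step.hyps by (simp add: divide_le_eq card_gt_0_iff mult.commute)
qed (rule assms(2))

lemma average_ge:
  assumes "average \<tau> A" "\<And>x. c \<le> f x"
  shows "c \<le> A f x"
  using average_le[OF assms(1), of "\<lambda>x. -1 * f x" "-c" x] assms(2) average_cmult[OF assms(1), of "-1" f x]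
  by simp

text \<open>Averages fix constants and are monotone, so a function already near a constant stays
  near it under further averaging.\<close>

lemma average_close:
  assumes "average \<tau> A" "\<And>x. \<bar>f x - c\<bar> \<le> e"
  shows "\<bar>A f x - c\<bar> \<le> e"
proof -
  have "f y \<le> c + e" "c - e \<le> f y" for y using assms(2)[of y] by auto
  then have "A f x \<le> c + e" "c - e \<le> A f x"
    by (auto intro: average_le[OF assms(1)] average_ge[OF assms(1)])
  then show ?thesis by simp
qed

text \<open>\<open>R\<close> stands for being close and is preserved by translations. Hence all
  averages share the modulus of continuity of \<open>f\<close>, whatever finite sets they
  use.\<close>

lemma average_modulus:
  assumes "average \<tau> A" "\<And>x y. R x y \<Longrightarrow> \<bar>f x - f y\<bar> \<le> (e::real)"
    and "\<And>g x y. R x y \<Longrightarrow> R (\<tau> g x) (\<tau> g y)" "R x y"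
  shows "\<bar>A f x - A f y\<bar> \<le> e"
  using assms(1,4)
proof (induction arbitrary: x y)
  case (average_step A N)
  have "\<bar>(\<Sum>g\<in>N. A f (\<tau> g x)) - (\<Sum>g\<in>N. A f (\<tau> g y))\<bar> \<le> (\<Sum>g\<in>N. \<bar>A f (\<tau> g x) - A f (\<tau> g y)\<bar>)"
    by (simp flip: sum_subtractf)
  also have "\<dots> \<le> card N * e"
    using sum_bounded_above[of N "\<lambda>g. \<bar>A f (\<tau> g x) - A f (\<tau> g y)\<bar>" e]
      average_step.IH average_step.prems assms(3) by simp
  finally show ?case
    using average_step.hyps
    by (simp add: divide_le_eq card_gt_0_iff mult.commute flip: diff_divide_distrib)
qed (rule assms(2))

lemma average_continuous:
  assumes "average \<tau> A" "continuous_on UNIV f" "\<And>g. continuous_on UNIV (\<tau> g)"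
  shows "continuous_on UNIV (A f)"
  using assms(1)
proof induction
  case (average_step A N)
  have "continuous_on UNIV (\<lambda>x. A f (\<tau> g x))" for g
    using continuous_on_compose2[OF average_step.IH assms(3)] by simp
  then show ?case using average_step.hyps by (intro continuous_intros) auto
qed (rule assms(2))

lemma average_translate_commute:
  assumes "average \<tau> A" "\<And>g x. \<tau> g (s x) = s (\<tau> g x)"
  shows "A (\<lambda>x. f (s x)) x = A f (s x)"
  using assms(1) by (induction arbitrary: x) (simp_all add: assms(2))

text \<open>Commuting translations let finite sums be interchanged; left and right translations of a
  group are the intended instance, by associativity.\<close>

lemma average_commute:
  assumes A: "average \<tau> A" and B: "average \<sigma> B"
    and comm: "\<And>g h x. \<tau> g (\<sigma> h x) = \<sigma> h (\<tau> g x)"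
  shows "A (B f) x = B (A f) x"
  using B
proof (induction arbitrary: x)
  case (average_step B N)
  have shift: "A (\<lambda>x. B f (\<sigma> h x)) x = A (B f) (\<sigma> h x)" for h
    by (rule average_translate_commute[OF A, where f = "B f" and s = "\<sigma> h"]) (rule comm)
  have "A (\<lambda>x. (\<Sum>h\<in>N. B f (\<sigma> h x)) / card N) x
      = (\<Sum>h\<in>N. A (\<lambda>x. B f (\<sigma> h x)) x) / card N"
    using average_cmult[OF A, of "1 / card N" "\<lambda>x. \<Sum>h\<in>N. B f (\<sigma> h x)"]
    by (simp add: average_sum[OF A])
  also have "\<dots> = (\<Sum>h\<in>N. A (B f) (\<sigma> h x)) / card N"
    by (simp only: shift)
  also have "\<dots> = (\<Sum>h\<in>N. B (A f) (\<sigma> h x)) / card N"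
    by (simp add: average_step.IH)
  finally show ?case .
qed simp

text \<open>
  The limit value is the least upper bound that averages of \<open>f\<close> can have: if an average is almost
  optimal but has a dip, then averaging it over \<open>N\<close> moves the dip across the whole space and
  beats the optimum.
\<close>

lemma average_tends_to_constant:
  fixes R :: "real \<Rightarrow> 'a \<Rightarrow> 'a \<Rightarrow> bool" and f :: "'a \<Rightarrow> real"
  assumes inv: "\<And>r g x y. R r x y \<Longrightarrow> R r (\<tau> g x) (\<tau> g y)"
    and cover: "\<And>r. r > 0 \<Longrightarrow> \<exists>N. finite N \<and> (\<forall>x y. \<exists>g\<in>N. R r (\<tau> g x) y)"
    and uc: "\<And>e. e > 0 \<Longrightarrow> \<exists>r>0. \<forall>x y. R r x y \<longrightarrow> \<bar>f x - f y\<bar> \<le> e"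
    and bdd: "\<And>x. \<bar>f x\<bar> \<le> b"
  shows "\<exists>c. \<forall>e>0. \<exists>A. average \<tau> A \<and> (\<forall>x. \<bar>A f x - c\<bar> \<le> e)"
proof -
  \<comment> \<open>All upper bounds of averages; its infimum \<open>s\<close> will be the limit
    constant.\<close>
  define S where "S = {c. \<exists>A. average \<tau> A \<and> (\<forall>x. A f x \<le> c)}"
  have "b \<in> S" unfolding S_def using average_id[of \<tau>] bdd by (auto simp: abs_le_iff)
  have lb: "-b \<le> c" if c: "c \<in> S" for c
  proof -
    obtain A where A: "average \<tau> A" "\<forall>x. A f x \<le> c" using c unfolding S_def by blast
    have "-b \<le> A f undefined"
      using bdd by (intro average_ge[OF A(1)]) (metis abs_le_iff minus_le_iff)
    then show ?thesis using A(2) by (meson order_trans)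
  qed
  define s where "s = Inf S"
  have s_le: "s \<le> c" if "c \<in> S" for c
    unfolding s_def using that lb by (intro cInf_lower bdd_belowI)
  have "\<exists>A. average \<tau> A \<and> (\<forall>x. \<bar>A f x - s\<bar> \<le> e)" if e: "e > 0" for e
  proof -
    obtain r where r: "r > 0" "\<And>x y. R r x y \<Longrightarrow> \<bar>f x - f y\<bar> \<le> e / 2"
      using uc[of "e / 2"] e by auto
    obtain N where N: "finite N" "\<And>x y. \<exists>g\<in>N. R r (\<tau> g x) y"
      using cover[OF r(1)] by blast
    have ne: "N \<noteq> {}" using N(2) by blast
    define n where "n = real (card N)"
    have n: "n \<ge> 1" using N(1) ne by (simp add: n_def Suc_le_eq card_gt_0_iff)
    \<comment> \<open>The allowed distance from the optimum. As \<open>n * t = e / 2\<close>, the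
      excess of all \<open>n\<close> summands together does not outweigh one dip of depth
      \<open>e / 2\<close>.\<close>
    define t where "t = e / (2 * n)"
    have t: "t > 0" "t \<le> e" using e n by (simp_all add: t_def field_simps)
    have tn: "n * t = e / 2" using n by (simp add: t_def)
    obtain c where c: "c \<in> S" "c < s + t"
      using cInf_lessD[of S "s + t"] \<open>b \<in> S\<close> t(1) unfolding s_def by auto
    then obtain A where A: "average \<tau> A" "\<forall>x. A f x \<le> c" unfolding S_def by blast
    have A_le: "A f x \<le> s + t" for x using A(2)[rule_format, of x] c(2) by linarith
    have "s - e \<le> A f z" for z
    proof (rule ccontr)
      assume z: "\<not> ?thesis"
      let ?B = "\<lambda>f x. (\<Sum>g\<in>N. A f (\<tau> g x)) / card N"
      have B: "average \<tau> ?B" by (rule average_step[OF A(1) N(1) ne])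
      have "?B f x \<le> (n * (s + t) - t - e / 2) / n" for x
      proof -
        \<comment> \<open>Some translate of \<open>x\<close> lands near the dip \<open>z\<close>, so
          one summand is at most \<open>s - e / 2\<close> while the others are at most
          \<open>s + t\<close>.\<close>
        obtain g where g: "g \<in> N" "R r (\<tau> g x) z" using N(2) by blast
        have "\<bar>A f (\<tau> g x) - A f z\<bar> \<le> e / 2"
          by (rule average_modulus[where R = "R r", OF A(1) r(2) inv g(2)])
        then have "A f (\<tau> g x) \<le> s - e / 2" using z by linarith
        moreover have "(\<Sum>h\<in>N - {g}. A f (\<tau> h x)) \<le> (n - 1) * (s + t)"
        proof -
          have "card (N - {g}) = card N - 1" using g(1) N(1) by simp
          then have "real (card (N - {g})) = n - 1" using n by (simp add: n_def of_nat_diff)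
          then show ?thesis
            using sum_bounded_above[of "N - {g}" "\<lambda>h. A f (\<tau> h x)" "s + t"] A_le by simp
        qed
        ultimately have "(\<Sum>h\<in>N. A f (\<tau> h x)) \<le> n * (s + t) - t - e / 2"
          using sum.remove[OF N(1) g(1), of "\<lambda>h. A f (\<tau> h x)"] by (simp add: algebra_simps)
        then show ?thesis using n unfolding n_def by (intro divide_right_mono) auto
      qed
      then have "(n * (s + t) - t - e / 2) / n \<in> S" using B by (auto simp: S_def)
      from s_le[OF this] have "n * s \<le> n * (s + t) - t - e / 2"
        using n by (simp add: le_divide_eq mult.commute)
      then show False using tn t(1) by (simp add: algebra_simps)
    qed
    moreover have "A f z \<le> s + e" for z using A_le[of z] t(2) by linarith
    ultimately show ?thesis using A(1) by (intro exI[of _ A]) (auto simp: abs_le_iff algebra_simps)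
  qed
  then show ?thesis by blast
qed

section \<open>Nets and uniform continuity for a bi-invariant metric\<close>

locale compact_bi_invariant_group =
  fixes d :: "'g::topological_group_add \<Rightarrow> 'g \<Rightarrow> real"
  assumes compact_group: "compact (UNIV :: 'g set)"
    and compatible: "compatible_metric d"
    and bi_invariant: "bi_invariant d"
begin

sublocale Metric_space "UNIV :: 'g set" d
  using compatible by (simp add: compatible_metric_def)

lemma d_left: "d (g + x) (g + y) = d x y" and d_right: "d (x + g) (y + g) = d x y"
  using bi_invariant by (auto simp: bi_invariant_def)

lemma mtopology_eq: "mtopology = (euclidean :: 'g topology)"
  using compatible by (simp add: compatible_metric_def)

lemma open_d_ball: "open {y. d x y < r}"
  using openin_mball[of x r] by (simp add: mtopology_eq mball_def)

lemma continuous_d: "continuous_on UNIV (\<lambda>g. d g h)"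
  unfolding continuous_on_def
proof
  fix g :: 'g
  show "((\<lambda>g. d g h) \<longlongrightarrow> d g h) (at g)"
  proof (rule tendstoI)
    fix e :: real assume "e > 0"
    have "\<bar>d k h - d g h\<bar> < e" if "d g k < e" for k
      using that triangle[of k g h] triangle[of g k h] commute[of g k] by auto
    then show "\<forall>\<^sub>F k in at g. dist (d k h) (d g h) < e"
      unfolding eventually_at_topological using open_d_ball[of g e] \<open>e > 0\<close>
      by (intro exI[of _ "{k. d g k < e}"]) (auto simp: dist_real_def)
  qed
qed

lemma d_net:
  assumes "r > 0"
  shows "\<exists>N. finite N \<and> (\<forall>x. \<exists>g\<in>N. d g x < r)"
proof -
  have "UNIV \<subseteq> (\<Union>x\<in>UNIV. {y. d x y < r})" using assms by auto
  with compact_group open_d_ball obtain N where "finite N" "UNIV \<subseteq> (\<Union>x\<in>N. {y. d x y < r})"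
    by (rule compactE_image)
  then show ?thesis by blast
qed

text \<open>By left invariance \<open>x + g\<close> is near \<open>y\<close> as soon as
  \<open>g\<close> is near \<open>- x + y\<close>, so one finite net serves all pairs.\<close>

lemma d_net_right: "r > 0 \<Longrightarrow> \<exists>N. finite N \<and> (\<forall>x y. \<exists>g\<in>N. d (x + g) y < r)"
proof -
  assume "r > 0"
  then obtain N where N: "finite N" "\<And>x. \<exists>g\<in>N. d g x < r" using d_net by blast
  have "\<exists>g\<in>N. d (x + g) y < r" for x y
    using N(2)[of "- x + y"] d_left[of x _ "- x + y"] by (simp add: add.assoc[symmetric])
  then show ?thesis using N(1) by blast
qed

lemma d_net_left: "r > 0 \<Longrightarrow> \<exists>N. finite N \<and> (\<forall>x y. \<exists>g\<in>N. d (g + x) y < r)"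
proof -
  assume "r > 0"
  then obtain N where N: "finite N" "\<And>x. \<exists>g\<in>N. d g x < r" using d_net by blast
  have "\<exists>g\<in>N. d (g + x) y < r" for x y
    using N(2)[of "y - x"] d_right[of _ x "y - x"] by simp
  then show ?thesis using N(1) by blast
qed

text \<open>The Heine-Cantor theorem with respect to \<open>d\<close>. Balls of radius
  \<open>r x\<close> cover while the estimate holds on balls of twice that radius, which leaves room
  for a second nearby point.\<close>

lemma uniformly_continuous_d:
  fixes f :: "'g \<Rightarrow> real"
  assumes f: "continuous_on UNIV f" and "e > 0"
  shows "\<exists>r>0. \<forall>x y. d x y < r \<longrightarrow> \<bar>f x - f y\<bar> \<le> e"
proof -
  have "\<exists>r>0. \<forall>y. d x y < 2 * r \<longrightarrow> \<bar>f x - f y\<bar> < e / 2" for x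
  proof -
    have "open (f -` {f x - e / 2 <..< f x + e / 2})"
      using f by (intro open_vimage) auto
    then have "openin mtopology (f -` {f x - e / 2 <..< f x + e / 2})"
      by (simp add: mtopology_eq)
    then obtain r where r: "r > 0" "mball x r \<subseteq> f -` {f x - e / 2 <..< f x + e / 2}"
      using \<open>e > 0\<close> unfolding openin_mtopology by force
    have "\<bar>f x - f y\<bar> < e / 2" if "d x y < 2 * (r / 2)" for y
    proof -
      have "y \<in> mball x r" using that by (simp add: mball_def)
      then have "f y \<in> {f x - e / 2 <..< f x + e / 2}" using r(2) by blast
      then show ?thesis using abs_diff_less_iff[of "f y" "f x" "e / 2"] abs_minus_commute[of "f x" "f y"] by simp
    qed
    then show ?thesis using r(1) by (intro exI[of _ "r / 2"]) auto
  qed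
  then obtain r where r: "\<And>x. r x > 0"
    "\<And>x y. d x y < 2 * r x \<Longrightarrow> \<bar>f x - f y\<bar> < e / 2" by metis
  have "UNIV \<subseteq> (\<Union>x\<in>UNIV. {y. d x y < r x})" using r(1) by auto
  with compact_group open_d_ball obtain N where N: "finite N" "UNIV \<subseteq> (\<Union>x\<in>N. {y. d x y < r x})"
    by (rule compactE_image)
  then have "N \<noteq> {}" by auto
  define q where "q = Min (r ` N)"
  have "q > 0" using N(1) \<open>N \<noteq> {}\<close> r(1) by (simp add: q_def)
  moreover have "\<bar>f x - f y\<bar> \<le> e" if "d x y < q" for x y
  proof -
    obtain z where z: "z \<in> N" "d z x < r z" using N(2) by auto
    have "q \<le> r z" using z(1) N(1) by (simp add: q_def)
    then have "d z y < 2 * r z" using z(2) that triangle[of z x y] by simp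
    moreover have "d z x < 2 * r z" using z(2) r(1)[of z] by simp
    ultimately show ?thesis using r(2)[of z x] r(2)[of z y] by linarith
  qed
  ultimately show ?thesis by blast
qed

lemma bounded_continuous:
  fixes f :: "'g \<Rightarrow> real"
  assumes "continuous_on UNIV f"
  shows "\<exists>b. \<forall>x. \<bar>f x\<bar> \<le> b"
  using compact_imp_bounded[OF compact_continuous_image[OF assms compact_group]]
  by (auto simp: bounded_iff)

section \<open>Existence, uniqueness and basic properties of the mean\<close>

abbreviation right_average :: "(('g \<Rightarrow> real) \<Rightarrow> 'g \<Rightarrow> real) \<Rightarrow> bool" where
  "right_average \<equiv> average (\<lambda>g x. x + g)"

abbreviation left_average :: "(('g \<Rightarrow> real) \<Rightarrow> 'g \<Rightarrow> real) \<Rightarrow> bool" where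
  "left_average \<equiv> average (+)"

definition is_mean :: "('g \<Rightarrow> real) \<Rightarrow> real \<Rightarrow> bool" where
  "is_mean f c \<longleftrightarrow> (\<forall>e>0. \<exists>A. right_average A \<and> (\<forall>x. \<bar>A f x - c\<bar> \<le> e))"

text \<open>The choice is meaningful once some constant satisfies \<open>is_mean f\<close>, which
  continuity of \<open>f\<close> guarantees; hence the continuity hypotheses in the rules
  below.\<close>

definition mean :: "('g \<Rightarrow> real) \<Rightarrow> real" where
  "mean f = (SOME c. is_mean f c)"

lemma is_mean_mean:
  assumes "continuous_on UNIV f"
  shows "is_mean f (mean f)"
proof -
  obtain b where "\<And>x. \<bar>f x\<bar> \<le> b" using bounded_continuous[OF assms] by blast
  then have "\<exists>c. is_mean f c"
    unfolding is_mean_def using uniformly_continuous_d[OF assms]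
    by (intro average_tends_to_constant[where R = "\<lambda>r x y. d x y < r"])
      (auto simp: d_right d_net_right)
  then show ?thesis unfolding mean_def by (rule someI_ex)
qed

text \<open>Left averages commute with right ones, so they pin down the value.\<close>

lemma is_mean_unique:
  assumes f: "continuous_on UNIV f" and a: "is_mean f a" and b: "is_mean f b"
  shows "a = b"
proof -
  obtain m where "\<And>x. \<bar>f x\<bar> \<le> m" using bounded_continuous[OF f] by blast
  then have "\<exists>c. \<forall>e>0. \<exists>B. left_average B \<and> (\<forall>x. \<bar>B f x - c\<bar> \<le> e)"
    using uniformly_continuous_d[OF f]
    by (intro average_tends_to_constant[where R = "\<lambda>r x y. d x y < r"])
      (auto simp: d_left d_net_left)
  then obtain c where c: "\<And>e. e > 0 \<Longrightarrow> \<exists>B. left_average B \<and> (\<forall>x. \<bar>B f x - c\<bar> \<le> e)"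
    by blast
  have "a = c" if a: "is_mean f a" for a
  proof (rule ccontr)
    assume "a \<noteq> c"
    define e where "e = \<bar>a - c\<bar> / 3"
    have "e > 0" using \<open>a \<noteq> c\<close> by (simp add: e_def)
    obtain A where A: "right_average A" "\<And>x. \<bar>A f x - a\<bar> \<le> e"
      using a \<open>e > 0\<close> unfolding is_mean_def by blast
    obtain B where B: "left_average B" "\<And>x. \<bar>B f x - c\<bar> \<le> e"
      using c[OF \<open>e > 0\<close>] by blast
    \<comment> \<open>One double average, evaluated at an arbitrary point, is near \<open>c\<close>
      in one order and near \<open>a\<close> in the other.\<close>
    have "\<bar>A (B f) 0 - c\<bar> \<le> e" by (rule average_close[OF A(1) B(2)])
    moreover have "\<bar>B (A f) 0 - a\<bar> \<le> e" by (rule average_close[OF B(1) A(2)])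
    moreover have "A (B f) 0 = B (A f) 0"
      by (rule average_commute[OF A(1) B(1)]) (simp add: add.assoc)
    ultimately have "\<bar>a - c\<bar> \<le> 2 * e" by linarith
    then show False using \<open>e > 0\<close> by (simp add: e_def)
  qed
  then show ?thesis using a b by blast
qed

lemma mean_eqI: "continuous_on UNIV f \<Longrightarrow> is_mean f c \<Longrightarrow> mean f = c"
  using is_mean_unique is_mean_mean by blast

lemma continuous_right_average:
  "right_average A \<Longrightarrow> continuous_on UNIV f \<Longrightarrow> continuous_on UNIV (A f)"
  by (rule average_continuous) (auto intro!: continuous_intros)

text \<open>Averages of \<open>A f\<close> are themselves averages of \<open>f\<close>, so the mean
  of \<open>A f\<close> is also a mean of \<open>f\<close>, and uniqueness applies.\<close>

lemma mean_average:
  assumes f: "continuous_on UNIV f" and A: "right_average A"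
  shows "mean (A f) = mean f"
proof -
  have "is_mean f (mean (A f))"
    using is_mean_mean[OF continuous_right_average[OF A f]] average_comp[OF _ A]
    unfolding is_mean_def by meson
  then show ?thesis by (rule mean_eqI[OF f, symmetric])
qed

lemma mean_translate:
  assumes "continuous_on UNIV f"
  shows "mean (\<lambda>x. f (x + g)) = mean f"
  by (rule mean_average[OF assms average_translate])

lemma mean_add:
  fixes f h :: "'g \<Rightarrow> real"
  assumes f: "continuous_on UNIV f" and h: "continuous_on UNIV h"
  shows "mean (\<lambda>x. f x + h x) = mean f + mean h"
proof (rule mean_eqI)
  show "continuous_on UNIV (\<lambda>x. f x + h x)" using f h by (intro continuous_intros)
  show "is_mean (\<lambda>x. f x + h x) (mean f + mean h)"
    unfolding is_mean_def
  proof (intro allI impI)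
    fix e :: real assume "e > 0"
    then have e2: "e / 2 > 0" by simp
    obtain A where A: "right_average A" "\<And>x. \<bar>A f x - mean f\<bar> \<le> e / 2"
      using is_mean_mean[OF f] e2 unfolding is_mean_def by blast
    \<comment> \<open>\<open>B\<close> is chosen for \<open>A h\<close> instead of \<open>h\<close>,
      so that the single average \<open>B\<close> after \<open>A\<close> serves both summands:
      \<open>B\<close> does not spoil the closeness of \<open>A f\<close>, and \<open>A h\<close>
      has the mean of \<open>h\<close>.\<close>
    obtain B where B: "right_average B" "\<And>x. \<bar>B (A h) x - mean h\<bar> \<le> e / 2"
      using is_mean_mean[OF continuous_right_average[OF A(1) h]] e2
      unfolding is_mean_def mean_average[OF h A(1)] by blast
    have "\<bar>B (A (\<lambda>x. f x + h x)) x - (mean f + mean h)\<bar> \<le> e" for x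
    proof -
      have "A (\<lambda>x. f x + h x) = (\<lambda>x. A f x + A h x)"
        by (rule ext) (rule average_add[OF A(1)])
      then have "B (A (\<lambda>x. f x + h x)) x = B (A f) x + B (A h) x"
        by (simp add: average_add[OF B(1)])
      then show ?thesis
        using average_close[of _ B "A f" "mean f" "e / 2" x, OF B(1) A(2)] B(2)[of x] by linarith
    qed
    then show "\<exists>A. right_average A \<and> (\<forall>x. \<bar>A (\<lambda>x. f x + h x) x - (mean f + mean h)\<bar> \<le> e)"
      using average_comp[OF B(1) A(1)] by blast
  qed
qed

lemma mean_cmult:
  assumes f: "continuous_on UNIV f"
  shows "mean (\<lambda>x. c * f x) = c * mean f"
proof (rule mean_eqI)
  show "continuous_on UNIV (\<lambda>x. c * f x)" using f by (intro continuous_intros)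
  show "is_mean (\<lambda>x. c * f x) (c * mean f)"
    unfolding is_mean_def
  proof (intro allI impI)
    fix e :: real assume "e > 0"
    then have "e / (\<bar>c\<bar> + 1) > 0" by simp
    then obtain A where A: "right_average A" "\<And>x. \<bar>A f x - mean f\<bar> \<le> e / (\<bar>c\<bar> + 1)"
      using is_mean_mean[OF f] unfolding is_mean_def by blast
    have "\<bar>A (\<lambda>x. c * f x) x - c * mean f\<bar> \<le> e" for x
    proof -
      have "\<bar>A (\<lambda>x. c * f x) x - c * mean f\<bar> = \<bar>c\<bar> * \<bar>A f x - mean f\<bar>"
        by (simp add: average_cmult[OF A(1)] flip: abs_mult right_diff_distrib)
      also have "\<dots> \<le> (\<bar>c\<bar> + 1) * (e / (\<bar>c\<bar> + 1))"
        by (intro mult_mono A(2)) auto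
      finally show ?thesis by simp
    qed
    then show "\<exists>A. right_average A \<and> (\<forall>x. \<bar>A (\<lambda>x. c * f x) x - c * mean f\<bar> \<le> e)"
      using A(1) by blast
  qed
qed

lemma mean_const: "mean (\<lambda>_. c) = c"
proof (rule mean_eqI)
  show "is_mean (\<lambda>_. c) c"
    unfolding is_mean_def by (intro allI impI exI[of _ "\<lambda>f. f"] conjI average_id) simp
qed (rule continuous_on_const)

lemma mean_diff:
  assumes "continuous_on UNIV f" "continuous_on UNIV h"
  shows "mean (\<lambda>x. f x - h x) = mean f - mean h"
proof -
  have "mean (\<lambda>x. f x + - 1 * h x) = mean f + mean (\<lambda>x. - 1 * h x)"
    by (intro mean_add continuous_intros assms)
  then show ?thesis using mean_cmult[OF assms(2), of "- 1"] by simp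
qed

lemma mean_sum:
  assumes "finite I" "\<And>i. i \<in> I \<Longrightarrow> continuous_on UNIV (F i)"
  shows "mean (\<lambda>x. \<Sum>i\<in>I. F i x) = (\<Sum>i\<in>I. mean (F i))"
  using assms
proof (induction I rule: finite_induct)
  case (insert i I)
  have "mean (\<lambda>x. F i x + (\<Sum>i\<in>I. F i x)) = mean (F i) + mean (\<lambda>x. \<Sum>i\<in>I. F i x)"
    using insert.prems by (intro mean_add continuous_on_sum) auto
  then show ?case using insert by simp
qed (simp add: mean_const)

lemma mean_ge_const:
  assumes "continuous_on UNIV f" "\<And>x. c \<le> f x"
  shows "c \<le> mean f"
proof (rule field_le_epsilon)
  fix e :: real assume "e > 0"
  then obtain A where A: "right_average A" "\<And>x. \<bar>A f x - mean f\<bar> \<le> e"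
    using is_mean_mean[OF assms(1)] unfolding is_mean_def by blast
  then show "c \<le> mean f + e"
    using average_ge[of _ A c f 0, OF A(1) assms(2)] A(2)[of 0] by linarith
qed

lemma mean_mono:
  assumes "continuous_on UNIV f" "continuous_on UNIV h" "\<And>x. f x \<le> h x"
  shows "mean f \<le> mean h"
proof -
  have "0 \<le> mean (\<lambda>x. h x - f x)"
    by (intro mean_ge_const continuous_intros assms(1,2)) (simp add: assms(3))
  then show ?thesis using mean_diff[OF assms(2,1)] by simp
qed

lemma mean_abs_le:
  assumes f: "continuous_on UNIV f" and h: "continuous_on UNIV h" and le: "\<And>x. \<bar>f x\<bar> \<le> h x"
  shows "\<bar>mean f\<bar> \<le> mean h"
proof (rule abs_leI)
  have le': "f x \<le> h x" "- 1 * f x \<le> h x" for x using le[of x] by auto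
  show "mean f \<le> mean h" by (rule mean_mono[OF f h le'(1)])
  have "mean (\<lambda>x. - 1 * f x) \<le> mean h"
    by (intro mean_mono continuous_intros f h le'(2))
  then show "- mean f \<le> mean h" using mean_cmult[OF f, of "- 1"] by simp
qed

text \<open>
  Finitely many translates of a bump cover the group, so its mean is positive and it can be
  normalized.
\<close>

lemma normalized_bump:
  assumes "r > 0"
  shows "\<exists>\<phi> L. continuous_on UNIV \<phi> \<and> (\<forall>g. 0 \<le> \<phi> g) \<and> mean \<phi> = 1 \<and>
    (\<forall>g. \<phi> g \<noteq> 0 \<longrightarrow> d g 0 \<le> r) \<and> L > 0 \<and> (\<forall>g h. \<bar>\<phi> g - \<phi> h\<bar> \<le> L * d g h)"
proof -
  \<comment> \<open>A tent function: it is 1-Lipschitz for \<open>d\<close> and vanishes outside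
    radius \<open>r\<close>.\<close>
  define b where "b g = max 0 (r - d g 0)" for g
  have cont: "continuous_on UNIV b"
    unfolding b_def by (intro continuous_intros continuous_d)
  \<comment> \<open>With radius \<open>r / 2\<close> the tent is at least \<open>r / 2\<close> at
    the nearby translate, which bounds the sum of translates below by a positive constant.\<close>
  obtain N where N: "finite N" "\<And>x y. \<exists>g\<in>N. d (x + g) y < r / 2"
    using d_net_right[of "r / 2"] assms by auto
  have contN: "continuous_on UNIV (\<lambda>x. b (x + g))" for g
    by (rule continuous_on_compose2[OF cont]) (auto intro!: continuous_intros)
  have "r / 2 \<le> mean (\<lambda>x. \<Sum>g\<in>N. b (x + g))"
  proof (rule mean_ge_const)
    show "continuous_on UNIV (\<lambda>x. \<Sum>g\<in>N. b (x + g))" by (intro continuous_intros contN)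
    fix x
    obtain g where g: "g \<in> N" "d (x + g) 0 < r / 2" using N(2) by blast
    have "r / 2 \<le> b (x + g)" using g(2) by (auto simp: b_def max_def)
    also have "\<dots> \<le> (\<Sum>g\<in>N. b (x + g))"
      using g(1) N(1) by (intro member_le_sum) (auto simp: b_def)
    finally show "r / 2 \<le> (\<Sum>g\<in>N. b (x + g))" .
  qed
  also have "\<dots> = card N * mean b"
    by (simp add: mean_sum[OF N(1) contN] mean_translate[OF cont])
  finally have "card N * mean b > 0" using assms by linarith
  then have pos: "mean b > 0" by (simp add: zero_less_mult_iff)
  define \<phi> where "\<phi> g = 1 / mean b * b g" for g
  have "\<bar>\<phi> g - \<phi> h\<bar> \<le> 1 / mean b * d g h" for g h
  proof -
    have "\<bar>b g - b h\<bar> \<le> d g h"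
      using triangle[of g h 0] triangle[of h g 0] commute[of g h] by (auto simp: b_def)
    moreover have "\<bar>\<phi> g - \<phi> h\<bar> = 1 / mean b * \<bar>b g - b h\<bar>"
      using pos by (simp add: \<phi>_def abs_mult flip: diff_divide_distrib)
    ultimately show ?thesis using pos by (simp add: divide_right_mono)
  qed
  moreover have "continuous_on UNIV \<phi>" unfolding \<phi>_def by (intro continuous_intros cont)
  moreover have "mean \<phi> = 1" unfolding \<phi>_def mean_cmult[OF cont] using pos by simp
  moreover have "0 \<le> \<phi> g" for g using pos by (simp add: \<phi>_def b_def)
  moreover have "d g 0 \<le> r" if "\<phi> g \<noteq> 0" for g using that by (auto simp: \<phi>_def b_def)
  ultimately show ?thesis using pos by (intro exI[of _ \<phi>] exI[of _ "1 / mean b"]) auto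
qed

end

section \<open>Smoothing on homogeneous spaces\<close>

text \<open>The weights are normalized tents around a finite net, so only values \<open>f y\<close>
  with \<open>y\<close> within \<open>e\<close> of \<open>x\<close> enter. Continuity of the weights
  suffices, because smoothing later makes them Lipschitz.\<close>

lemma lipschitz_partition_approximation:
  assumes "compact (UNIV :: 'm::metric_space set)" "e > 0"
  shows "\<exists>Y (u :: 'm \<Rightarrow> 'm \<Rightarrow> real). finite Y \<and> (\<forall>y\<in>Y. continuous_on UNIV (u y)) \<and>
    (\<forall>f K x. K-lipschitz_on UNIV f \<longrightarrow> \<bar>(\<Sum>y\<in>Y. f y * u y x) - f x\<bar> \<le> K * e)"
proof -
  have cover: "(UNIV :: 'm set) \<subseteq> (\<Union>y\<in>UNIV. ball y e)" using assms(2) by auto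
  obtain Y :: "'m set" where Y: "finite Y" "UNIV \<subseteq> (\<Union>y\<in>Y. ball y e)"
    by (rule compactE_image[OF assms(1), of UNIV "\<lambda>y. ball y e"]) (use cover in auto)
  define w where "w y x = max 0 (e - dist y x)" for x y :: 'm
  define W where "W x = (\<Sum>y\<in>Y. w y x)" for x
  have w: "w y x \<ge> 0" for x y by (simp add: w_def)
  have W: "W x > 0" for x
  proof -
    obtain y where y: "y \<in> Y" "dist y x < e" using Y(2) by (auto simp: subset_eq)
    have "w y x \<le> W x" unfolding W_def by (rule member_le_sum[OF y(1) w Y(1)])
    moreover have "0 < w y x" using y(2) by (simp add: w_def)
    ultimately show ?thesis by linarith
  qed
  have "continuous_on UNIV (\<lambda>x. w y x / W x)" for y
    using W unfolding w_def W_def by (intro continuous_intros) (auto simp: less_imp_neq[symmetric])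
  moreover have "\<bar>(\<Sum>y\<in>Y. f y * (w y x / W x)) - f x\<bar> \<le> K * e" if f: "K-lipschitz_on UNIV f" for f K x
  proof -
    have K: "K \<ge> 0" using f by (rule lipschitz_on_nonneg)
    have "(\<Sum>y\<in>Y. f y * (w y x / W x)) - f x = (\<Sum>y\<in>Y. f y * w y x) / W x - f x * W x / W x"
      using W[of x] by (simp add: sum_divide_distrib)
    also have "\<dots> = (\<Sum>y\<in>Y. (f y - f x) * w y x) / W x"
      by (simp add: W_def left_diff_distrib sum_subtractf sum_distrib_left diff_divide_distrib)
    finally have "\<bar>(\<Sum>y\<in>Y. f y * (w y x / W x)) - f x\<bar> = \<bar>\<Sum>y\<in>Y. (f y - f x) * w y x\<bar> / W x"
      using W[of x] by simp
    also have "\<dots> \<le> (\<Sum>y\<in>Y. K * e * w y x) / W x"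
    proof (intro divide_right_mono order_trans[OF sum_abs] sum_mono)
      fix y
      show "\<bar>(f y - f x) * w y x\<bar> \<le> K * e * w y x"
      proof (cases "dist y x < e")
        case True
        have "\<bar>f y - f x\<bar> \<le> K * dist y x"
          using lipschitz_onD[OF f, of y x] by (simp add: dist_real_def)
        also have "\<dots> \<le> K * e" using True K by (intro mult_left_mono) auto
        finally show ?thesis using w[of y x] by (simp add: abs_mult mult_right_mono)
      qed (simp add: w_def)
    qed (use W[of x] in simp)
    also have "\<dots> = K * e" using W[of x] by (simp add: W_def flip: sum_distrib_left)
    finally show ?thesis .
  qed
  ultimately show ?thesis using Y(1) by (intro exI[of _ Y] exI[of _ "\<lambda>y x. w y x / W x"]) blast
qed

section \<open>Comparing the metric of the homogeneous space with that of the group\<close>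

locale compact_homogeneous_space = compact_bi_invariant_group d
  for d :: "'g::topological_group_add \<Rightarrow> 'g \<Rightarrow> real" +
  fixes act :: "'g \<Rightarrow> 'm::metric_space \<Rightarrow> 'm" and p :: 'm
  assumes homogeneous: "homogeneous_space act"
    and invariant: "invariant_metric act dist"
    and quotient: "quotient_metric act p d dist"
begin

lemma act_zero: "act 0 x = x" and act_add: "act (g + h) x = act g (act h x)"
  and transitive: "\<exists>g. act g x = y"
  using homogeneous by (auto simp: homogeneous_space_def)

lemma dist_act: "dist (act g x) (act g y) = dist x y"
  using invariant by (simp add: invariant_metric_def)

lemma continuous_act: "continuous_on UNIV (\<lambda>g. act g x)"
proof -
  have "continuous_on UNIV (\<lambda>(g, x). act g x)"
    using homogeneous by (simp add: homogeneous_space_def)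
  then have "continuous_on UNIV (\<lambda>g. (\<lambda>(g, x). act g x) (g, x))"
    by (rule continuous_on_compose2) (auto intro!: continuous_intros)
  then show ?thesis by simp
qed

lemma compact_space: "compact (UNIV :: 'm set)"
proof -
  have "range (\<lambda>g. act g p) = UNIV" using transitive by (metis surjI)
  then show ?thesis using compact_continuous_image[OF continuous_act compact_group] by metis
qed

text \<open>The infimum is at most its term for \<open>h1 = h2 = 0\<close>, and right invariance
  removes the element \<open>k\<close> that carries \<open>p\<close> to \<open>x\<close>.\<close>

lemma dist_act_le: "dist (act g x) (act h x) \<le> d g h"
proof -
  obtain k where k: "x = act k p" using transitive by metis
  have "d (g + k + 0) (h + k + 0) \<in> {d (g + k + h1) (h + k + h2) | h1 h2.
      h1 \<in> stabilizer act p \<and> h2 \<in> stabilizer act p}"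
    using act_zero by (force simp: stabilizer_def)
  then have "Inf {d (g + k + h1) (h + k + h2) | h1 h2.
      h1 \<in> stabilizer act p \<and> h2 \<in> stabilizer act p} \<le> d (g + k + 0) (h + k + 0)"
    by (rule cInf_lower) (auto intro!: bdd_belowI[of _ 0])
  then have "dist (act (g + k) p) (act (h + k) p) \<le> d (g + k + 0) (h + k + 0)"
    using quotient by (simp add: quotient_metric_def)
  then show ?thesis by (simp add: k act_add d_right)
qed

text \<open>Every term of the infimum is a distance between lifts of \<open>x\<close> and
  \<open>y\<close>. This is how Lipschitz bounds proved on the group descend to the
  quotient.\<close>

lemma le_dist_if_le_d:
  assumes "\<And>g h. act g p = x \<Longrightarrow> act h p = y \<Longrightarrow> c \<le> d g h"
  shows "c \<le> dist x y"
proof -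
  obtain g h where gh: "act g p = x" "act h p = y" using transitive by metis
  have "c \<le> Inf {d (g + h1) (h + h2) | h1 h2. h1 \<in> stabilizer act p \<and> h2 \<in> stabilizer act p}"
  proof (rule cInf_greatest)
    show "{d (g + h1) (h + h2) | h1 h2. h1 \<in> stabilizer act p \<and> h2 \<in> stabilizer act p} \<noteq> {}"
      using act_zero by (auto simp: stabilizer_def)
  qed (use gh in \<open>auto simp: stabilizer_def act_add intro!: assms\<close>)
  also have "\<dots> = dist x y" using quotient gh by (auto simp: quotient_metric_def)
  finally show ?thesis .
qed

end

section \<open>Smoothing by a kernel on the group\<close>

locale smoothing_kernel = compact_homogeneous_space d act p
  for d :: "'g::topological_group_add \<Rightarrow> 'g \<Rightarrow> real" and act :: "'g \<Rightarrow> 'm::metric_space \<Rightarrow> 'm" and p +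
  fixes \<phi> :: "'g \<Rightarrow> real" and L r :: real
  assumes continuous_kernel: "continuous_on UNIV \<phi>"
    and kernel_nonneg: "0 \<le> \<phi> g"
    and mean_kernel: "mean \<phi> = 1"
    and kernel_support: "\<phi> g \<noteq> 0 \<Longrightarrow> d g 0 \<le> r"
    and kernel_pos: "L > 0"
    and kernel_lipschitz: "\<bar>\<phi> g - \<phi> h\<bar> \<le> L * d g h"
begin

definition smooth :: "('m \<Rightarrow> real) \<Rightarrow> 'm \<Rightarrow> real" where
  "smooth f x = mean (\<lambda>g. \<phi> g * f (act g x))"

lemma continuous_act_fun: "continuous_on UNIV f \<Longrightarrow> continuous_on UNIV (\<lambda>g. f (act g x))"
  by (rule continuous_on_compose2[OF _ continuous_act]) auto

lemma continuous_integrand: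
  "continuous_on UNIV f \<Longrightarrow> continuous_on UNIV (\<lambda>g. \<phi> g * f (act g x))"
  by (intro continuous_intros continuous_kernel continuous_act_fun)

lemma smooth_sum:
  assumes "finite Y" "\<And>y. y \<in> Y \<Longrightarrow> continuous_on UNIV (u y)"
  shows "smooth (\<lambda>x. \<Sum>y\<in>Y. c y * u y x) x = (\<Sum>y\<in>Y. c y * smooth (u y) x)"
proof -
  have "smooth (\<lambda>x. \<Sum>y\<in>Y. c y * u y x) x = mean (\<lambda>g. \<Sum>y\<in>Y. c y * (\<phi> g * u y (act g x)))"
    by (simp add: smooth_def sum_distrib_left mult.left_commute)
  also have "\<dots> = (\<Sum>y\<in>Y. mean (\<lambda>g. c y * (\<phi> g * u y (act g x))))"
    by (intro mean_sum assms continuous_intros continuous_integrand) auto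
  also have "\<dots> = (\<Sum>y\<in>Y. c y * smooth (u y) x)"
    by (intro sum.cong refl) (simp add: smooth_def mean_cmult continuous_integrand assms)
  finally show ?thesis .
qed

lemma smooth_diff:
  assumes "continuous_on UNIV f" "continuous_on UNIV h"
  shows "smooth (\<lambda>x. f x - h x) x = smooth f x - smooth h x"
  using mean_diff[OF continuous_integrand[OF assms(1)] continuous_integrand[OF assms(2)]]
  by (simp add: smooth_def right_diff_distrib)

lemma abs_smooth_le:
  assumes "continuous_on UNIV f" "\<And>g. \<phi> g \<noteq> 0 \<Longrightarrow> \<bar>f (act g x)\<bar> \<le> c"
  shows "\<bar>smooth f x\<bar> \<le> c"
proof -
  have "\<bar>smooth f x\<bar> \<le> mean (\<lambda>g. c * \<phi> g)"
    unfolding smooth_def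
  proof (rule mean_abs_le[OF continuous_integrand[OF assms(1)]])
    fix g
    show "\<bar>\<phi> g * f (act g x)\<bar> \<le> c * \<phi> g"
      using kernel_nonneg[of g] assms(2)[of g] mult_left_mono[of "\<bar>f (act g x)\<bar>" c "\<phi> g"]
      by (cases "\<phi> g = 0") (auto simp: abs_mult mult.commute)
  qed (intro continuous_intros continuous_kernel)
  then show ?thesis by (simp add: mean_cmult[OF continuous_kernel] mean_kernel)
qed

text \<open>By invariance of the metric each translate of \<open>f\<close> is again
  \<open>K\<close>-Lipschitz, and a weighted mean with nonnegative weight of mean 1 keeps the
  constant.\<close>

lemma smooth_lipschitz:
  assumes f: "K-lipschitz_on UNIV f"
  shows "K-lipschitz_on UNIV (smooth f)"
proof (rule lipschitz_onI)
  fix x y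
  have cont: "continuous_on UNIV f" by (rule lipschitz_on_continuous_on[OF f])
  have "smooth f x - smooth f y = mean (\<lambda>g. \<phi> g * f (act g x) - \<phi> g * f (act g y))"
    by (simp add: smooth_def mean_diff continuous_integrand cont)
  also have "\<bar>\<dots>\<bar> \<le> mean (\<lambda>g. K * dist x y * \<phi> g)"
  proof (rule mean_abs_le)
    fix g
    have "\<bar>f (act g x) - f (act g y)\<bar> \<le> K * dist x y"
      using lipschitz_onD[OF f, of "act g x" "act g y"] by (simp add: dist_act dist_real_def)
    then show "\<bar>\<phi> g * f (act g x) - \<phi> g * f (act g y)\<bar> \<le> K * dist x y * \<phi> g"
      using kernel_nonneg[of g] mult_left_mono[of "\<bar>f (act g x) - f (act g y)\<bar>" "K * dist x y" "\<phi> g"]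
      by (simp add: abs_mult mult.commute flip: right_diff_distrib)
  qed (intro continuous_intros continuous_kernel continuous_act_fun cont)+
  also have "\<dots> = K * dist x y" by (simp add: mean_cmult[OF continuous_kernel] mean_kernel)
  finally show "dist (smooth f x) (smooth f y) \<le> K * dist x y" by (simp add: dist_real_def)
qed (rule lipschitz_on_nonneg[OF f])

text \<open>Constants are reproduced because the kernel has mean 1, and elements in its support move
  \<open>x\<close> by at most \<open>r\<close>.\<close>

lemma smooth_close:
  assumes f: "K-lipschitz_on UNIV f"
  shows "\<bar>smooth f x - f x\<bar> \<le> K * r"
proof -
  have cont: "continuous_on UNIV f" by (rule lipschitz_on_continuous_on[OF f])
  have "smooth (\<lambda>_. f x) x = f x"
    using mean_cmult[OF continuous_kernel, of "f x"]
    by (simp add: smooth_def mean_kernel mult.commute)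
  then have "smooth f x - f x = smooth (\<lambda>y. f y - f x) x"
    by (simp add: smooth_diff cont)
  also have "\<bar>\<dots>\<bar> \<le> K * r"
  proof (rule abs_smooth_le)
    show "continuous_on UNIV (\<lambda>y. f y - f x)" by (intro continuous_intros cont)
    fix g assume "\<phi> g \<noteq> 0"
    have "\<bar>f (act g x) - f x\<bar> \<le> K * dist (act g x) (act 0 x)"
      using lipschitz_onD[OF f, of "act g x" x] by (simp add: act_zero dist_real_def)
    also have "\<dots> \<le> K * r"
      using dist_act_le[of g x 0] kernel_support[OF \<open>\<phi> g \<noteq> 0\<close>]
      by (intro mult_left_mono lipschitz_on_nonneg[OF f]) linarith
    finally show "\<bar>f (act g x) - f x\<bar> \<le> K * r" .
  qed
  finally show ?thesis .
qed

text \<open>Right invariance of the mean, with \<open>h = g + k\<close>, shifts the dependence on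
  the point from \<open>f\<close> to the kernel.\<close>

lemma smooth_act:
  assumes f: "continuous_on UNIV f"
  shows "smooth f (act k p) = mean (\<lambda>h. \<phi> (h - k) * f (act h p))"
proof -
  have "mean (\<lambda>h. \<phi> (h + - k) * f (act (h + - k) (act k p))) = smooth f (act k p)"
    using mean_translate[OF continuous_integrand[OF f, of "act k p"], of "- k"] by (simp add: smooth_def)
  then show ?thesis by (simp add: add.assoc flip: act_add)
qed

text \<open>By \<open>smooth_act\<close> the point enters only through the kernel, so mere
  boundedness of \<open>f\<close> gives a Lipschitz bound in the lifts; since it holds for all
  lifts, it passes to the quotient metric.\<close>

lemma smooth_bounded_lipschitz:
  assumes f: "continuous_on UNIV f" and c: "\<And>x. \<bar>f x\<bar> \<le> c"
  shows "(L * c)-lipschitz_on UNIV (smooth f)"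
proof (rule lipschitz_onI)
  have c0: "c \<ge> 0" using c[of p] by linarith
  then show "0 \<le> L * c" using kernel_pos by simp
  fix x y :: 'm
  have le: "\<bar>smooth f x - smooth f y\<bar> \<le> L * c * d g h" if gh: "act g p = x" "act h p = y" for g h
  proof -
    have cont: "continuous_on UNIV (\<lambda>j. \<phi> (j - k) * f (act j p))" for k
    proof -
      have "continuous_on UNIV (\<lambda>j. \<phi> (j + - k))"
        by (rule continuous_on_compose2[OF continuous_kernel]) (auto intro!: continuous_intros)
      then show ?thesis by (intro continuous_intros continuous_act_fun f) simp
    qed
    have "smooth f x - smooth f y
        = mean (\<lambda>j. \<phi> (j - g) * f (act j p) - \<phi> (j - h) * f (act j p))"
      unfolding gh[symmetric] by (simp add: smooth_act[OF f] mean_diff cont)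
    also have "\<bar>\<dots>\<bar> \<le> mean (\<lambda>_. L * c * d g h)"
    proof (rule mean_abs_le)
      fix j
      \<comment> \<open>Bi-invariance makes inversion an isometry.\<close>
      have "d (j - g) (j - h) = d (- g) (- h)"
        using d_left[of j "- g" "- h"] by simp
      also have "\<dots> = d h g"
        using d_left[of g "- g" "- h"] d_right[of "0" h "g - h"] by simp
      finally have "\<bar>\<phi> (j - g) - \<phi> (j - h)\<bar> \<le> L * d g h"
        using kernel_lipschitz[of "j - g" "j - h"] by (simp add: commute)
      then have "\<bar>\<phi> (j - g) - \<phi> (j - h)\<bar> * \<bar>f (act j p)\<bar> \<le> (L * d g h) * c"
        using c c0 kernel_pos by (intro mult_mono) auto
      then show "\<bar>\<phi> (j - g) * f (act j p) - \<phi> (j - h) * f (act j p)\<bar> \<le> L * c * d g h"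
        by (simp add: mult_ac flip: abs_mult left_diff_distrib)
    qed (intro continuous_intros cont)+
    finally show ?thesis by (simp add: mean_const)
  qed
  show "dist (smooth f x) (smooth f y) \<le> L * c * dist x y"
  \<comment> \<open>The other case divides by \<open>L * c\<close>.\<close>
  proof (cases "c = 0")
    case True
    obtain g h where "act g p = x" "act h p = y" using transitive by metis
    from le[OF this] show ?thesis using True by simp
  next
    case False
    then have pos: "L * c > 0" using c0 kernel_pos by simp
    have "\<bar>smooth f x - smooth f y\<bar> / (L * c) \<le> dist x y"
      using le pos by (intro le_dist_if_le_d) (simp add: divide_le_eq mult.commute)
    then show ?thesis using pos by (simp add: dist_real_def divide_le_eq mult.commute)
  qed
qed

end

section \<open>Finite rank approximation with Lipschitz control\<close>

context compact_homogeneous_space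
begin

text \<open>
  Smoothing turns the uniform approximation by a partition of unity into an approximation with
  respect to the Lipschitz norm, at the cost of a factor \<open>L\<close> that depends on the kernel only.
\<close>

lemma lipschitz_approximation:
  assumes "e > 0"
  shows "\<exists>Y (a :: 'm \<Rightarrow> 'm \<Rightarrow> real). finite Y \<and>
      (\<forall>y\<in>Y. \<exists>K. K-lipschitz_on UNIV (a y)) \<and>
      (\<forall>f K. K-lipschitz_on UNIV f \<longrightarrow>
        ((1 + e) * K)-lipschitz_on UNIV (\<lambda>x. \<Sum>y\<in>Y. f y * a y x) \<and>
        (\<forall>x. \<bar>(\<Sum>y\<in>Y. f y * a y x) - f x\<bar> \<le> e * K))"
proof -
  have "e / 2 > 0" using assms by simp
  from normalized_bump[OF this] obtain \<phi> L where "smoothing_kernel d act p \<phi> L (e / 2)"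
    unfolding smoothing_kernel_def smoothing_kernel_axioms_def
    using compact_homogeneous_space_axioms by metis
  then interpret smoothing_kernel d act p \<phi> L "e / 2" .
  \<comment> \<open>The kernel comes first, so \<open>L\<close> is fixed here. The bound
    \<open>e / L\<close> absorbs the factor \<open>L\<close> in the Lipschitz estimate;
    \<open>e / 2\<close> is the share of the uniform error left over by the kernel radius.\<close>
  define \<epsilon> where "\<epsilon> = min (e / 2) (e / L)"
  have \<epsilon>: "\<epsilon> > 0" "\<epsilon> \<le> e / 2" "L * \<epsilon> \<le> e"
    using assms kernel_pos by (auto simp: \<epsilon>_def min_def field_simps)
  obtain Y and u :: "'m \<Rightarrow> 'm \<Rightarrow> real" where Y: "finite Y"
    and u: "\<And>y. y \<in> Y \<Longrightarrow> continuous_on UNIV (u y)"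
    and close: "\<And>f K x. K-lipschitz_on UNIV f \<Longrightarrow> \<bar>(\<Sum>y\<in>Y. f y * u y x) - f x\<bar> \<le> K * \<epsilon>"
    using lipschitz_partition_approximation[OF compact_space \<epsilon>(1)] by blast
  have "\<exists>K. K-lipschitz_on UNIV (smooth (u y))" if y: "y \<in> Y" for y
  proof -
    obtain c where "\<And>x. \<bar>u y x\<bar> \<le> c"
      using compact_imp_bounded[OF compact_continuous_image[OF u[OF y] compact_space]]
      by (auto simp: bounded_iff)
    then show ?thesis using smooth_bounded_lipschitz[OF u[OF y]] by blast
  qed
  moreover have "((1 + e) * K)-lipschitz_on UNIV (\<lambda>x. \<Sum>y\<in>Y. f y * smooth (u y) x)"
    and "\<bar>(\<Sum>y\<in>Y. f y * smooth (u y) x) - f x\<bar> \<le> e * K"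
    if f: "K-lipschitz_on UNIV f" for f K x
  proof -
    have K: "K \<ge> 0" using f by (rule lipschitz_on_nonneg)
    have cont: "continuous_on UNIV f" by (rule lipschitz_on_continuous_on[OF f])
    have contS: "continuous_on UNIV (\<lambda>x. \<Sum>y\<in>Y. f y * u y x)"
      by (intro continuous_intros u)
    define v where "v x = (\<Sum>y\<in>Y. f y * u y x) - f x" for x
    have contv: "continuous_on UNIV v"
      unfolding v_def by (intro continuous_intros contS cont)
    have v: "\<bar>v x\<bar> \<le> K * \<epsilon>" for x unfolding v_def by (rule close[OF f])
    \<comment> \<open>By linearity the operator is smoothing of \<open>f\<close>, which keeps the
      constant \<open>K\<close>, plus smoothing of the uniformly small error \<open>v\<close>, whose
      Lipschitz constant is controlled by its sup norm.\<close>
    have eq: "(\<Sum>y\<in>Y. f y * smooth (u y) x) = smooth f x + smooth v x" for x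
      using smooth_diff[OF contS cont, of x] smooth_sum[OF Y u, where c = f and x = x] by (simp add: v_def[abs_def])
    have "(K + L * (K * \<epsilon>))-lipschitz_on UNIV (\<lambda>x. smooth f x + smooth v x)"
      by (intro lipschitz_on_add smooth_lipschitz f smooth_bounded_lipschitz contv v)
    moreover have "K + L * (K * \<epsilon>) \<le> (1 + e) * K"
      using mult_left_mono[OF \<epsilon>(3) K] by (simp add: algebra_simps)
    ultimately show "((1 + e) * K)-lipschitz_on UNIV (\<lambda>x. \<Sum>y\<in>Y. f y * smooth (u y) x)"
      unfolding eq by (rule lipschitz_on_le)
    have "\<bar>smooth v x\<bar> \<le> K * \<epsilon>" by (rule abs_smooth_le[OF contv v])
    moreover have "K * \<epsilon> \<le> K * (e / 2)" using \<epsilon>(2) K by (intro mult_left_mono)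
    moreover have "K * (e / 2) + K * (e / 2) = e * K" by simp
    ultimately show "\<bar>(\<Sum>y\<in>Y. f y * smooth (u y) x) - f x\<bar> \<le> e * K"
      using smooth_close[OF f, of x] unfolding eq by linarith
  qed
  ultimately show ?thesis using Y by (intro exI[of _ Y] exI[of _ "\<lambda>y. smooth (u y)"]) blast
qed

end

theorem theorem3p7:
  fixes act :: "'g::topological_group_add \<Rightarrow> 'm::pointed_metric_space \<Rightarrow> 'm"
    and d :: "'g \<Rightarrow> 'g \<Rightarrow> real"
    and p :: 'm
  assumes "compact (UNIV :: 'g set)"
    and "homogeneous_space act"
    and "invariant_metric act (dist :: 'm \<Rightarrow> 'm \<Rightarrow> real)"
    and "compatible_metric d"
    and "bi_invariant d"
    and "quotient_metric act p d (dist :: 'm \<Rightarrow> 'm \<Rightarrow> real)"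
  shows "metric_approximation_property TYPE('m lipschitz_free)"
proof -
  interpret compact_homogeneous_space d act p
    by unfold_locales (rule assms)+
  show ?thesis
    by (rule metric_approximation_property_lipschitz_free_if_approximable
        [OF compact_imp_bounded[OF compact_space] lipschitz_approximation])
qed

end
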